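(* Let $\mathcal{R}^*$ be a read collection closed under reverse complement, $k$ the order, $m$ the minimum overlap parameter, and let $n$ be the number of rows (dBG nodes, solid and linker) of the BOSS matrix $M$ of order $k$ of $\mathcal{R}^*$. There is a data structure using $4n+o(n)$ bits (i.e., $4+o(1)$ bits per dBG node) that, given a node $v$ as a row index of $M$, computes $\texttt{nextcontained}(v)$ in $\mathcal{O}(1)$ time and $\texttt{buildL}(v,m)$ in $\mathcal{O}(k)$ time.
   Context: DNA alphabet $\Sigma=\{\texttt{a},\texttt{c},\texttt{g},\texttt{t}\}$ plus a dummy symbol $\$$, smaller than all symbols of $\Sigma$. The reverse complement $R^{rc}$ of a string $R$ reverses $R$ and exchanges $\texttt{a}\leftrightarrow\texttt{t}$, $\texttt{c}\leftrightarrow\texttt{g}$. $\mathcal{R}=\{R_1,\dots,R_r\}$ is a set of reads of equal length and $\mathcal{R}^*=\mathcal{R}\cup\{R_i^{rc}\}$. Solid nodes of order $k$ are the distinct length-$(k-1)$ substrings of strings of $\mathcal{R}^*$; for every prefix $X$ of length $d<k-1$ of a string of $\mathcal{R}^*$ there is a linker node $\$^{k-1-d}X$ with $\texttt{llabel}(\$^{k-1-d}X)=X$. The matrix $M$ has one row per solid or linker node, sorted in colexicographic order (lexicographic order of the reversed strings). A linker node $v'$ is contained in a node $v$ if $\texttt{llabel}(v')$ is a suffix of $v$ (for linker $v$, of $\texttt{llabel}(v)$). $\texttt{nextcontained}(v)$ returns the linker node $v'\neq v$ contained in $v$ with the longest $\texttt{llabel}$ among those whose $\texttt{llabel}$ is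 a proper suffix of the non-$\$$ part of $v$ and has length at least $m$ (a dummy value if none exists). $\texttt{buildL}(v,m)$ returns the set of all linker nodes contained in $v$ whose $\texttt{llabel}$ is a suffix of $v$ of length at least $m$ (obtained by iterating $\texttt{nextcontained}$). Time is measured in the word-RAM model. *)

theory Defs
  imports
    Complex_Main
    "HOL-Library.Sublist"
    "HOL-Library.List_Lexorder"
    "HOL-Library.Landau_Symbols"
begin

section \<open>Reads and nodes of the BOSS matrix\<close>

datatype dna = Adenine | Cytosine | Guanine | Thymine

fun complement :: "dna \<Rightarrow> dna" where
  "complement Adenine = Thymine"
| "complement Cytosine = Guanine"
| "complement Guanine = Cytosine"
| "complement Thymine = Adenine"

definition reverse_complement :: "dna list \<Rightarrow> dna list" where
  "reverse_complement X = rev (map complement X)"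

definition rc_closure :: "dna list set \<Rightarrow> dna list set" where
  "rc_closure Rs = Rs \<union> reverse_complement ` Rs"

datatype symbol = Dollar | Base dna

fun symbol_rank :: "symbol \<Rightarrow> nat" where
  "symbol_rank Dollar = 0"
| "symbol_rank (Base Adenine) = 1"
| "symbol_rank (Base Cytosine) = 2"
| "symbol_rank (Base Guanine) = 3"
| "symbol_rank (Base Thymine) = 4"

lemma symbol_rank_inject: "symbol_rank x = symbol_rank y \<longleftrightarrow> x = y"
  by (cases x rule: symbol_rank.cases; cases y rule: symbol_rank.cases) simp_all

instantiation symbol :: linorder
begin

definition less_eq_symbol :: "symbol \<Rightarrow> symbol \<Rightarrow> bool" where
  "x \<le> y \<longleftrightarrow> symbol_rank x \<le> symbol_rank y"

definition less_symbol :: "symbol \<Rightarrow> symbol \<Rightarrow> bool" where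
  "x < y \<longleftrightarrow> symbol_rank x < symbol_rank y"

instance
  by standard (auto simp: less_eq_symbol_def less_symbol_def symbol_rank_inject)

end

definition solid_nodes :: "dna list set \<Rightarrow> nat \<Rightarrow> symbol list set" where
  "solid_nodes Rs k =
     {map Base X | X. length X = k - 1 \<and> (\<exists>R\<in>rc_closure Rs. sublist X R)}"

definition linker_nodes :: "dna list set \<Rightarrow> nat \<Rightarrow> symbol list set" where
  "linker_nodes Rs k =
     {replicate (k - 1 - length X) Dollar @ map Base X | X.
        length X < k - 1 \<and> (\<exists>R\<in>rc_closure Rs. prefix X R)}"

definition boss_nodes :: "dna list set \<Rightarrow> nat \<Rightarrow> symbol list set" where
  "boss_nodes Rs k = solid_nodes Rs k \<union> linker_nodes Rs k"

text \<open>The part of a node after its leading dummy symbols; this is the whole string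
  if the node is solid.\<close>

definition llabel :: "symbol list \<Rightarrow> symbol list" where
  "llabel v = dropWhile (\<lambda>x. x = Dollar) v"

text \<open>The order on lists is the lexicographic one, so that the nodes themselves appear in
  colexicographic order.\<close>

definition boss_rows :: "dna list set \<Rightarrow> nat \<Rightarrow> symbol list list" where
  "boss_rows Rs k = map rev (sorted_list_of_set (rev ` boss_nodes Rs k))"

text \<open>Rows are numbered from 1, which leaves 0 as the dummy value.\<close>

definition row_of :: "dna list set \<Rightarrow> nat \<Rightarrow> symbol list \<Rightarrow> nat" where
  "row_of Rs k v = Suc (THE i. i < length (boss_rows Rs k) \<and> boss_rows Rs k ! i = v)"

definition contained_in :: "dna list set \<Rightarrow> nat \<Rightarrow> symbol list \<Rightarrow> symbol list \<Rightarrow> bool" where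
  "contained_in Rs k u v \<longleftrightarrow> u \<in> linker_nodes Rs k \<and> suffix (llabel u) (llabel v)"

definition nextcontained ::
    "dna list set \<Rightarrow> nat \<Rightarrow> nat \<Rightarrow> symbol list \<Rightarrow> symbol list option" where
  "nextcontained Rs k m v =
     (let S = {u. u \<noteq> v \<and> contained_in Rs k u v \<and>
                  strict_suffix (llabel u) (llabel v) \<and> m \<le> length (llabel u)}
      in if S = {} then None else Some (arg_max_on (\<lambda>u. length (llabel u)) S))"

definition buildL ::
    "dna list set \<Rightarrow> nat \<Rightarrow> symbol list \<Rightarrow> nat \<Rightarrow> symbol list set" where
  "buildL Rs k v m = {u. contained_in Rs k u v \<and> m \<le> length (llabel u)}"

fun row_or_dummy :: "dna list set \<Rightarrow> nat \<Rightarrow> symbol list option \<Rightarrow> nat" where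
  "row_or_dummy Rs k None = 0"
| "row_or_dummy Rs k (Some u) = row_of Rs k u"


section \<open>The word-RAM\<close>

text \<open>The machine has word length \<open>w\<close>. Registers and memory cells hold numbers below
  \<open>2 ^ w\<close>, and each instruction costs one unit of time. Jump targets are absolute positions
  in the program; the machine halts when the program counter leaves the program. Answers
  are written word by word to an output list.\<close>

datatype binop = Add | Sub | Mul | Div | Mod | BitAnd | BitOr | BitXor | ShiftL | ShiftR

datatype instr =
    Const nat nat
  | WordLength nat
  | Arith binop nat nat nat
  | Load nat nat
  | Store nat nat
  | Jump nat
  | JumpEq nat nat nat
  | JumpLess nat nat nat
  | Emit nat

fun eval_binop :: "nat \<Rightarrow> binop \<Rightarrow> nat \<Rightarrow> nat \<Rightarrow> nat" where
  "eval_binop w Add a b = take_bit w (a + b)"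
| "eval_binop w Sub a b = take_bit w (a + 2 ^ w - b)"
| "eval_binop w Mul a b = take_bit w (a * b)"
| "eval_binop w Div a b = a div b"
| "eval_binop w Mod a b = a mod b"
| "eval_binop w BitAnd a b = Bit_Operations.and a b"
| "eval_binop w BitOr a b = Bit_Operations.or a b"
| "eval_binop w BitXor a b = Bit_Operations.xor a b"
| "eval_binop w ShiftL a b = take_bit w (push_bit b a)"
| "eval_binop w ShiftR a b = drop_bit b a"

record ram =
  pc :: nat
  reg :: "nat \<Rightarrow> nat"
  mem :: "nat \<Rightarrow> nat"
  emitted :: "nat list"

fun exec :: "nat \<Rightarrow> instr \<Rightarrow> ram \<Rightarrow> ram" where
  "exec w (Const r a) s = s\<lparr>reg := (reg s)(r := take_bit w a)\<rparr>"
| "exec w (WordLength r) s = s\<lparr>reg := (reg s)(r := take_bit w w)\<rparr>"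
| "exec w (Arith f r p q) s = s\<lparr>reg := (reg s)(r := eval_binop w f (reg s p) (reg s q))\<rparr>"
| "exec w (Load r p) s = s\<lparr>reg := (reg s)(r := mem s (reg s p))\<rparr>"
| "exec w (Store p r) s = s\<lparr>mem := (mem s)(reg s p := reg s r)\<rparr>"
| "exec w (Jump l) s = s\<lparr>pc := l\<rparr>"
| "exec w (JumpEq p q l) s = (if reg s p = reg s q then s\<lparr>pc := l\<rparr> else s)"
| "exec w (JumpLess p q l) s = (if reg s p < reg s q then s\<lparr>pc := l\<rparr> else s)"
| "exec w (Emit r) s = s\<lparr>emitted := emitted s @ [reg s r]\<rparr>"

definition halted :: "instr list \<Rightarrow> ram \<Rightarrow> bool" where
  "halted P s \<longleftrightarrow> length P \<le> pc s"

definition step :: "nat \<Rightarrow> instr list \<Rightarrow> ram \<Rightarrow> ram" where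
  "step w P s = (if halted P s then s else exec w (P ! pc s) (s\<lparr>pc := Suc (pc s)\<rparr>))"

definition initial :: "nat \<Rightarrow> (nat \<Rightarrow> nat) \<Rightarrow> ram" where
  "initial x M = \<lparr>pc = 0, reg = (\<lambda>r. if r = 0 then x else 0), mem = M, emitted = []\<rparr>"

text \<open>Memory holds the bit string \<open>D\<close>, packed \<open>w\<close> bits per cell (least significant bit
  first, the last cell padded with zeros) from address 0 on. The cells beyond \<open>D\<close> are
  working memory of arbitrary content.\<close>

definition holds_bits :: "nat \<Rightarrow> bool list \<Rightarrow> (nat \<Rightarrow> nat) \<Rightarrow> bool" where
  "holds_bits w D M \<longleftrightarrow>
     (\<forall>a. M a < 2 ^ w) \<and>
     (\<forall>a. a * w < length D \<longrightarrow> M a = horner_sum of_bool 2 (take w (drop (a * w) D)))"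

text \<open>On query \<open>x\<close>, program \<open>P\<close> halts after at most \<open>t\<close> steps with an output satisfying
  \<open>Q\<close>, and leaves the data structure \<open>D\<close> intact for later queries.\<close>

definition answers ::
    "nat \<Rightarrow> instr list \<Rightarrow> bool list \<Rightarrow> nat \<Rightarrow> nat \<Rightarrow> (nat list \<Rightarrow> bool) \<Rightarrow> bool" where
  "answers w P D x t Q \<longleftrightarrow>
     (\<forall>M. holds_bits w D M \<longrightarrow>
        (let s = (step w P ^^ t) (initial x M)
         in halted P s \<and> Q (emitted s) \<and> holds_bits w D (mem s)))"

end

theory Submission
  imports
    Defs
    "HOL-Library.Discrete_Functions"
    "HOL-Real_Asymp.Real_Asymp"
begin

text \<open>
  Sending a row to the row of its \<open>nextcontained\<close> linker, or to a virtual row 0, makes the rows a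
  forest numbered in preorder: in colexicographic order the nodes ending in \<open>llabel u\<close> form an
  interval that starts at \<open>u\<close>, so parent edges do not cross, and \<open>buildL v m\<close> consists of the
  ancestors of \<open>v\<close> and possibly \<open>v\<close> itself.

  Each row stores four bits: whether it has a child, whether it is the last child of its parent,
  whether it is a pioneer, and whether it belongs to its own \<open>buildL\<close>. The first two bits let one
  replay the stack of the preorder traversal inside a block of \<open>\<Theta>(log n)\<close> rows, which gives the
  parent whenever it lies in the same block. The rows of a block \<open>b\<close> whose parents lie in a given
  earlier block \<open>b'\<close> have parents that run downwards through the stack left over at the end of
  \<open>b'\<close>, moving one entry at each last child, so it suffices to know the parent of the first such
  row, the pioneer. Because edges do not cross, only \<open>O(n / log n)\<close> pairs of blocks are joined by
  an edge, so there are that few pioneers. A pioneer stores the place of its parent relative to a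
  superblock of \<open>\<Theta>(log\<^sup>2 n)\<close> rows, in \<open>O(log log n)\<close> bits, and the superblock itself is stored once
  for each of the \<open>O(n / log\<^sup>2 n)\<close> joined pairs of superblocks. What has to be computed inside a block
  is tabulated for all \<open>O(\<surd>n)\<close> possible block contents.
\<close>

section \<open>Straight-line code for expressions\<close>

datatype expr =
    Num nat
  | Width
  | Input
  | Bin binop expr expr
  | Fetch expr

primrec expr_value :: "nat \<Rightarrow> (nat \<Rightarrow> nat) \<Rightarrow> nat \<Rightarrow> expr \<Rightarrow> nat" where
  "expr_value w M x (Num a) = take_bit w a"
| "expr_value w M x Width = take_bit w w"
| "expr_value w M x Input = x"
| "expr_value w M x (Bin f a b) = eval_binop w f (expr_value w M x a) (expr_value w M x b)"
| "expr_value w M x (Fetch a) = M (expr_value w M x a)"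

primrec compile :: "expr \<Rightarrow> nat \<Rightarrow> instr list" where
  "compile (Num a) r = [Const r a]"
| "compile Width r = [WordLength r]"
| "compile Input r = [Arith BitOr r 0 0]"
| "compile (Bin f a b) r = compile a r @ compile b (Suc r) @ [Arith f r r (Suc r)]"
| "compile (Fetch a) r = compile a r @ [Load r r]"

primrec code_at :: "instr list \<Rightarrow> nat \<Rightarrow> instr list \<Rightarrow> bool" where
  "code_at P l [] \<longleftrightarrow> True"
| "code_at P l (i # c) \<longleftrightarrow> (l < length P \<and> P ! l = i) \<and> code_at P (Suc l) c"

lemma code_at_append:
  "code_at P l (c @ d) \<longleftrightarrow> code_at P l c \<and> code_at P (l + length c) d"
  by (induction c arbitrary: l) auto

lemma code_at_self: "code_at P 0 P"
proof -
  have "code_at (pre @ c) (length pre) c" for pre c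
  proof (induction c arbitrary: pre)
    case (Cons i c)
    show ?case using Cons.IH[of "pre @ [i]"] by simp
  qed simp
  from this[of "[]"] show ?thesis by simp
qed

lemma step_instr:
  "pc s < length P \<Longrightarrow> P ! pc s = i \<Longrightarrow> step w P s = exec w i (s\<lparr>pc := Suc (pc s)\<rparr>)"
  by (simp add: step_def halted_def)

lemma funpow_step_halted: "halted P s \<Longrightarrow> (step w P ^^ t) s = s"
  by (induction t) (simp_all add: step_def)

lemma funpow_add_apply: "(f ^^ (a + b)) x = (f ^^ b) ((f ^^ a) x)"
  by (metis add.commute comp_apply funpow_add)

lemma compile_correct:
  assumes "code_at P (pc s) (compile e r)" and "0 < r"
  shows "\<exists>\<rho>. (step w P ^^ length (compile e r)) s =
             s\<lparr>pc := pc s + length (compile e r), reg := \<rho>\<rparr> \<and>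
             \<rho> r = expr_value w (mem s) (reg s 0) e \<and> (\<forall>q<r. \<rho> q = reg s q)"
  using assms
proof (induction e arbitrary: r s)
  case (Num a)
  then show ?case by (auto simp: step_instr)
next
  case Width
  then show ?case by (auto simp: step_instr)
next
  case Input
  then show ?case by (auto simp: step_instr)
next
  case (Bin f a b)
  have ca: "code_at P (pc s) (compile a r)"
    and cb: "code_at P (pc s + length (compile a r)) (compile b (Suc r))"
    and cc: "code_at P (pc s + length (compile a r) + length (compile b (Suc r)))
               [Arith f r r (Suc r)]"
    using Bin.prems(1) by (auto simp: code_at_append)
  obtain \<rho>1 where r1: "(step w P ^^ length (compile a r)) s =
        s\<lparr>pc := pc s + length (compile a r), reg := \<rho>1\<rparr>"
      "\<rho>1 r = expr_value w (mem s) (reg s 0) a" "\<forall>q<r. \<rho>1 q = reg s q"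
    using Bin.IH(1)[OF ca Bin.prems(2)] by blast
  let ?s1 = "s\<lparr>pc := pc s + length (compile a r), reg := \<rho>1\<rparr>"
  obtain \<rho>2 where r2: "(step w P ^^ length (compile b (Suc r))) ?s1 =
        ?s1\<lparr>pc := pc ?s1 + length (compile b (Suc r)), reg := \<rho>2\<rparr>"
      "\<rho>2 (Suc r) = expr_value w (mem ?s1) (reg ?s1 0) b" "\<forall>q<Suc r. \<rho>2 q = reg ?s1 q"
    using Bin.IH(2)[of ?s1 "Suc r"] cb by auto
  have z: "\<rho>1 0 = reg s 0" using r1(3) Bin.prems(2) by simp
  show ?case
    using r1 r2 z cc
    by (intro exI[of _ "\<rho>2(r := eval_binop w f (\<rho>2 r) (\<rho>2 (Suc r)))"])
      (simp add: funpow_add_apply step_instr fun_upd_def flip: add.assoc)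
next
  case (Fetch a)
  have ca: "code_at P (pc s) (compile a r)"
    and cc: "code_at P (pc s + length (compile a r)) [Load r r]"
    using Fetch.prems(1) by (auto simp: code_at_append)
  obtain \<rho>1 where r1: "(step w P ^^ length (compile a r)) s =
        s\<lparr>pc := pc s + length (compile a r), reg := \<rho>1\<rparr>"
      "\<rho>1 r = expr_value w (mem s) (reg s 0) a" "\<forall>q<r. \<rho>1 q = reg s q"
    using Fetch.IH[OF ca Fetch.prems(2)] by blast
  show ?case
    using r1 cc
    by (intro exI[of _ "\<rho>1(r := mem s (\<rho>1 r))"]) (simp add: step_instr fun_upd_def)
qed

definition next_program :: "expr \<Rightarrow> instr list" where
  "next_program e = compile e 1 @ [Emit 1]"

lemma next_program_answers:
  assumes "\<And>M. holds_bits w D M \<Longrightarrow> expr_value w M x e = y"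
    and "length (next_program e) \<le> t"
  shows "answers w (next_program e) D x t (\<lambda>out. out = [y])"
  unfolding answers_def Let_def
proof (intro allI impI)
  fix M assume M: "holds_bits w D M"
  let ?P = "next_program e" and ?n = "length (compile e 1)"
  have c: "code_at ?P 0 (compile e 1)" "code_at ?P ?n [Emit 1]"
    using code_at_self[of ?P] by (simp_all add: next_program_def code_at_append)
  obtain \<rho> where r: "(step w ?P ^^ ?n) (initial x M) = (initial x M)\<lparr>pc := ?n, reg := \<rho>\<rparr>"
      "\<rho> 1 = expr_value w M x e"
    using compile_correct[of ?P "initial x M" e 1 w] c(1) by (auto simp: initial_def)
  let ?s = "(initial x M)\<lparr>pc := Suc ?n, reg := \<rho>, emitted := [y]\<rparr>"
  have "(step w ?P ^^ length ?P) (initial x M) = ?s"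
    using r c(2) assms(1)[OF M]
    by (simp add: next_program_def step_instr initial_def)
  moreover have "halted ?P ?s" by (simp add: halted_def next_program_def)
  ultimately have "(step w ?P ^^ t) (initial x M) = ?s"
    using funpow_add_apply[of "length ?P" "t - length ?P" "step w ?P" "initial x M"]
      assms(2) funpow_step_halted by simp
  then show "halted ?P ((step w ?P ^^ t) (initial x M)) \<and>
      emitted ((step w ?P ^^ t) (initial x M)) = [y] \<and>
      holds_bits w D (mem ((step w ?P ^^ t) (initial x M)))"
    using \<open>halted ?P ?s\<close> M by (simp add: initial_def)
qed

definition build_program :: "expr \<Rightarrow> expr \<Rightarrow> instr list" where
  "build_program fe ne =
     (let l = length (compile fe 2) + 2; h = l + length (compile ne 2) + 4
      in compile fe 2 @ [JumpEq 2 1 l, Emit 0] @ compile ne 2 @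
         [Arith BitOr 0 2 2, JumpEq 0 1 h, Emit 0, Jump l])"

inductive chain :: "(nat \<Rightarrow> nat) \<Rightarrow> nat \<Rightarrow> nat list \<Rightarrow> bool" for p where
  stop: "p x = 0 \<Longrightarrow> chain p x []"
| more: "p x = Suc y \<Longrightarrow> chain p (Suc y) ys \<Longrightarrow> chain p x (Suc y # ys)"

lemma build_loop:
  fixes fe ne :: expr
  defines "P \<equiv> build_program fe ne"
  defines "l \<equiv> length (compile fe 2) + 2"
  assumes ne: "\<And>y. 0 < y \<Longrightarrow> y \<le> n \<Longrightarrow> expr_value w M y ne = p y" and p: "\<And>y. 0 < y \<Longrightarrow> p y < y"
    and "chain p x ys" and "0 < x" "x \<le> n"
    and "pc s = l" "reg s 0 = x" "reg s 1 = 0" "mem s = M"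
  shows "\<exists>t s'. t \<le> (length ys + 1) * (length (compile ne 2) + 4) \<and>
           (step w P ^^ t) s = s' \<and> halted P s' \<and> emitted s' = emitted s @ ys \<and> mem s' = M"
  using assms(5-)
proof (induction x ys arbitrary: s rule: chain.induct)
  let ?n = "length (compile ne 2)"
  have c: "code_at P l (compile ne 2)" "code_at P (l + ?n) [Arith BitOr 0 2 2]"
     "code_at P (l + ?n + 1) [JumpEq 0 1 (l + ?n + 4)]"
     "code_at P (l + ?n + 2) [Emit 0]" "code_at P (l + ?n + 3) [Jump l]"
    using code_at_self[of P]
    by (simp_all add: P_def build_program_def Let_def code_at_append l_def
       numeral_eq_Suc ac_simps)
  have len: "length P = l + ?n + 4"
    by (simp add: P_def build_program_def Let_def l_def)
  have body: "\<exists>\<rho>. (step w P ^^ (?n + 2)) s =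
        s\<lparr>pc := (if p x = 0 then l + ?n + 4 else l + ?n + 2), reg := \<rho>\<rparr> \<and> \<rho> 0 = p x \<and> \<rho> 1 = 0"
    if s: "pc s = l" "reg s 0 = x" "reg s 1 = 0" "mem s = M" and x: "0 < x" "x \<le> n" for s x
  proof -
    obtain \<rho> where r: "(step w P ^^ ?n) s = s\<lparr>pc := l + ?n, reg := \<rho>\<rparr>"
      "\<rho> 2 = expr_value w M x ne" "\<forall>q<2. \<rho> q = reg s q"
      using compile_correct[of P s ne 2 w] c(1) s by auto
    have "(step w P ^^ (?n + 2)) s = step w P (step w P ((step w P ^^ ?n) s))"
      by simp
    also have "\<dots> = s\<lparr>pc := (if p x = 0 then l + ?n + 4 else l + ?n + 2),
         reg := \<rho>(0 := p x)\<rparr>"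
      using r c(2,3) s ne[OF x] by (simp add: step_instr)
    finally show ?thesis using r(3) s by (intro exI[of _ "\<rho>(0 := p x)"]) simp
  qed
  {
    case (stop x)
    obtain \<rho> where r: "(step w P ^^ (?n + 2)) s = s\<lparr>pc := l + ?n + 4, reg := \<rho>\<rparr>"
      using body[of s x] stop by auto
    then show ?case
      using stop.prems by (intro exI[of _ "?n + 2"]) (simp add: halted_def len)
  next
    case (more x y ys)
    obtain \<rho> where r: "(step w P ^^ (?n + 2)) s = s\<lparr>pc := l + ?n + 2, reg := \<rho>\<rparr>"
       "\<rho> 0 = Suc y" "\<rho> 1 = 0"
      using body[of s x] more by auto
    let ?s = "s\<lparr>pc := l, reg := \<rho>, emitted := emitted s @ [Suc y]\<rparr>"
    have *: "(step w P ^^ (?n + 4)) s = ?s"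
    proof -
      have "(step w P ^^ (?n + 4)) s = step w P (step w P ((step w P ^^ (?n + 2)) s))"
        by (simp add: numeral_eq_Suc)
      also have "\<dots> = ?s"
        unfolding r(1) using r c(4,5) by (simp add: step_instr numeral_eq_Suc)
      finally show ?thesis .
    qed
    have "Suc y \<le> n" using p[of x] more by auto
    then obtain t s' where t: "t \<le> (length ys + 1) * (?n + 4)" "(step w P ^^ t) ?s = s'"
       "halted P s'" "emitted s' = emitted ?s @ ys" "mem s' = M"
      using more.IH[of ?s] r more.prems by auto
    show ?case
      using t * by (intro exI[of _ "?n + 4 + t"] exI[of _ s'])
        (simp add: funpow_add_apply)
  }
qed

lemma build_program_answers:
  fixes fe ne :: expr
  assumes "\<And>M y. holds_bits w D M \<Longrightarrow> 0 < y \<Longrightarrow> y \<le> n \<Longrightarrow> expr_value w M y ne = p y"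
    and "\<And>M. holds_bits w D M \<Longrightarrow> expr_value w M x fe = of_bool b"
    and p: "\<And>y. 0 < y \<Longrightarrow> p y < y" and ch: "chain p x ys" and x: "0 < x" "x \<le> n"
    and t: "length (compile fe 2) + 2 + (length ys + 1) * (length (compile ne 2) + 4) \<le> t"
  shows "answers w (build_program fe ne) D x t (\<lambda>out. out = (if b then [x] else []) @ ys)"
  unfolding answers_def Let_def
proof (intro allI impI)
  fix M assume M: "holds_bits w D M"
  let ?P = "build_program fe ne" and ?f = "length (compile fe 2)"
  let ?s = "initial x M" and ?out = "(if b then [x] else [])"
  have c: "code_at ?P 0 (compile fe 2)" "code_at ?P ?f [JumpEq 2 1 (?f + 2)]"
     "code_at ?P (?f + 1) [Emit 0]"
    using code_at_self[of ?P]
    by (simp_all add: build_program_def Let_def code_at_append numeral_eq_Suc)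
  obtain \<rho> where r: "(step w ?P ^^ ?f) ?s = ?s\<lparr>pc := ?f, reg := \<rho>\<rparr>"
      "\<rho> 2 = of_bool b" "\<forall>q<2. \<rho> q = reg ?s q"
    using compile_correct[of ?P ?s fe 2 w] c(1) assms(2)[OF M] by (auto simp: initial_def)
  have r01: "\<rho> 0 = x" "\<rho> 1 = 0" using r(3) by (simp_all add: initial_def)
  let ?s1 = "?s\<lparr>pc := ?f + 2, reg := \<rho>, emitted := ?out\<rparr>"
  have "\<exists>d\<le>2. (step w ?P ^^ (?f + d)) ?s = ?s1"
  proof (cases b)
    case True
    have "(step w ?P ^^ (?f + 2)) ?s = step w ?P (step w ?P ((step w ?P ^^ ?f) ?s))" by simp
    also have "\<dots> = ?s1" unfolding r(1) using r r01 c True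
      by (simp add: step_instr) (simp add: initial_def)
    finally show ?thesis by blast
  next
    case False
    have "(step w ?P ^^ (?f + 1)) ?s = step w ?P ((step w ?P ^^ ?f) ?s)" by simp
    also have "\<dots> = ?s1" unfolding r(1) using r r01 c False
      by (simp add: step_instr) (simp add: initial_def)
    finally show ?thesis by (intro exI[of _ 1]) simp
  qed
  then obtain d where d: "d \<le> 2" "(step w ?P ^^ (?f + d)) ?s = ?s1" by blast
  obtain u s' where u: "u \<le> (length ys + 1) * (length (compile ne 2) + 4)"
       "(step w ?P ^^ u) ?s1 = s'" "halted ?P s'" "emitted s' = emitted ?s1 @ ys" "mem s' = M"
    using build_loop[where fe = fe and ne = ne and w = w and M = M and n = n and p = p and x = x and ys = ys and s = ?s1]
      assms(1)[OF M] p ch x r01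
    by (auto simp: initial_def)
  have "t = ?f + d + u + (t - (?f + d + u))" using t u(1) d(1) by simp
  then have "(step w ?P ^^ t) ?s = s'"
    using d(2) u(2) funpow_step_halted[OF u(3)] by (metis funpow_add_apply)
  then show "halted ?P ((step w ?P ^^ t) ?s) \<and>
      emitted ((step w ?P ^^ t) ?s) = ?out @ ys \<and>
      holds_bits w D (mem ((step w ?P ^^ t) ?s))"
    using u(3-) M by simp
qed

section \<open>Reading arrays from packed bits\<close>

definition read_bits :: "expr \<Rightarrow> expr \<Rightarrow> expr" where
  "read_bits off len =
     Bin Mod
       (Bin BitOr
         (Bin ShiftR (Fetch (Bin Div off Width)) (Bin Mod off Width))
         (Bin ShiftL (Fetch (Bin Add (Bin Div off Width) (Num 1)))
           (Bin Sub Width (Bin Mod off Width))))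
       (Bin ShiftL (Num 1) len)"

lemma holds_bits_bit:
  assumes "holds_bits w D M" "i < length D" "0 < w"
  shows "bit (M (i div w)) (i mod w) = D ! i"
proof -
  have "i div w * w \<le> i" by simp
  then have lt: "i div w * w < length D" using assms(2) by linarith
  have i: "i div w * w + i mod w = i" by simp
  have "M (i div w) = horner_sum of_bool 2 (take w (drop (i div w * w) D))"
    using assms(1) lt unfolding holds_bits_def by blast
  moreover have "i mod w < length D - i div w * w" using assms(2) i by linarith
  moreover have "drop (i div w * w) D ! (i mod w) = D ! i" using lt i by simp
  moreover have "i mod w < w" using assms(3) by simp
  ultimately show ?thesis by (simp add: bit_horner_sum_bit_iff del: drop_drop)
qed

lemma eval_read_bits:
  assumes D: "holds_bits w D M" and "expr_value w M x eo = off" "expr_value w M x el = len"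
    and "Suc off < 2 ^ w" "len < w" "off + len \<le> length D"
  shows "expr_value w M x (read_bits eo el) = horner_sum of_bool 2 (take len (drop off D))"
proof -
  define a r where "a = off div w" and "r = off mod w"
  have w0: "0 < w" using assms(5) by simp
  have w: "take_bit w w = w" by (simp add: take_bit_nat_eq_self_iff)
  have r: "r < w" using w0 by (simp add: r_def)
  have "a \<le> off" by (simp add: a_def)
  then have a: "take_bit w (Suc a) = Suc a"
    using assms(4) by (simp add: take_bit_nat_eq_self_iff)
  have one: "take_bit w (Suc 0) = Suc 0" using w0 by (simp add: take_bit_nat_eq_self_iff)
  have len: "take_bit w (push_bit len (Suc 0)) = 2 ^ len"
    using assms(5) by (simp add: push_bit_eq_mult take_bit_nat_eq_self_iff)
  have sub: "take_bit w (w + 2 ^ w - r) = w - r"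
  proof -
    have "w + 2 ^ w - r = (w - r) + 2 ^ w" using r by simp
    moreover have "w - r < 2 ^ w" using less_exp[of w] by linarith
    ultimately show ?thesis by (simp only: take_bit_eq_mod mod_add_self2 mod_less)
  qed
  have off: "off = a * w + r" by (simp add: a_def r_def)
  have "expr_value w M x (read_bits eo el) =
      take_bit len (or (drop_bit r (M a)) (take_bit w (push_bit (w - r) (M (Suc a)))))"
    using assms(2,3,5)
    by (simp add: read_bits_def w one len sub a flip: a_def r_def take_bit_eq_mod)
  also have "\<dots> = horner_sum of_bool 2 (take len (drop off D))"
  proof (rule bit_eqI)
    fix j
    have lo: "bit (M a) (r + j) = D ! (off + j)" if "j < len" "r + j < w"
      using holds_bits_bit[OF D, of "off + j"] that assms(6) w0 unfolding off
      by (simp add: add.assoc div_mult_self3 )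
    have hi: "bit (M (Suc a)) (j - (w - r)) = D ! (off + j)" if "j < len" "\<not> r + j < w"
    proof -
      have "off + j = (j - (w - r)) + Suc a * w" using that r by (simp add: off)
      moreover have "j - (w - r) < w" using that assms(5) by linarith
      ultimately have "(off + j) div w = Suc a" "(off + j) mod w = j - (w - r)"
        using w0 by (simp_all only: div_mult_self3 mod_mult_self3 div_mult_self1 mod_mult_self1 div_less mod_less)
      then show ?thesis using holds_bits_bit[OF D, of "off + j"] that assms(6) w0 by simp
    qed
    have no: "\<not> bit (M a) (r + j)" if "\<not> r + j < w"
    proof -
      have "M a < 2 ^ w" using D by (simp add: holds_bits_def)
      then show ?thesis using that
        by (metis bit_take_bit_iff take_bit_nat_eq_self_iff)
    qed
    show "bit (take_bit len (or (drop_bit r (M a)) (take_bit w (push_bit (w - r) (M (Suc a)))))) j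
       = bit (horner_sum of_bool 2 (take len (drop off D)) :: nat) j"
      using lo hi no r assms(5,6)
      by (cases "j < len"; cases "r + j < w")
        (auto simp: bit_horner_sum_bit_iff bit_take_bit_iff bit_or_iff bit_drop_bit_eq
          bit_push_bit_iff)
  qed
  finally show ?thesis .
qed

definition nat_bits :: "nat \<Rightarrow> nat \<Rightarrow> bool list" where
  "nat_bits d x = map (bit x) [0..<d]"

lemma length_nat_bits [simp]: "length (nat_bits d x) = d"
  by (simp add: nat_bits_def)

lemma horner_sum_nat_bits: "x < 2 ^ d \<Longrightarrow> horner_sum of_bool 2 (nat_bits d x) = x"
  by (simp add: nat_bits_def horner_sum_bit_eq_take_bit take_bit_nat_eq_self_iff)

fun array_bits :: "nat \<times> nat list \<Rightarrow> bool list" where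
  "array_bits (d, xs) = concat (map (nat_bits d) xs)"

lemma length_array_bits: "length (array_bits (d, xs)) = length xs * d"
  by (induction xs) simp_all

lemma take_drop_array_bits:
  "i < length xs \<Longrightarrow> take d (drop (i * d) (array_bits (d, xs) @ ys)) = nat_bits d (xs ! i)"
  by (induction xs arbitrary: i) (auto simp: less_Suc_eq_0_disj)

declare array_bits.simps [simp del] length_array_bits [simp]

lemma eval_read_array:
  assumes D: "holds_bits w D M" and "D = pre @ array_bits (d, xs) @ post" and "length D < 2 ^ w"
    and "expr_value w M x eo = length pre + i * d" "expr_value w M x el = d"
    and "i < length xs" "xs ! i < 2 ^ d" "d < w" "0 < d"
  shows "expr_value w M x (read_bits eo el) = xs ! i"
proof -
  have "Suc i * d \<le> length xs * d" using assms(6) by (intro mult_right_mono) auto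
  then have le: "length pre + i * d + d \<le> length D"
    using assms(2) by simp
  have "expr_value w M x (read_bits eo el) =
      horner_sum of_bool 2 (take d (drop (length pre + i * d) D))"
    using le assms by (intro eval_read_bits[OF D]) auto
  also have "take d (drop (length pre + i * d) D) = nat_bits d (xs ! i)"
    using take_drop_array_bits[OF assms(6)] assms(2) by (simp add: add.commute[of "length pre"] flip: drop_drop)
  finally show ?thesis using assms(7) by (simp add: horner_sum_nat_bits)
qed

text \<open>The code does not depend on the word length, so the machine cannot know the field width
  \<open>b\<close> in advance; it recovers \<open>b\<close> from the leading ones in its first memory cell.\<close>

definition array_start :: "nat \<Rightarrow> (nat \<times> nat list) list \<Rightarrow> nat \<Rightarrow> nat" where
  "array_start b as j = 2 * b + 2 + 2 * length as * b + length (concat (map array_bits (take j as)))"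

definition directory :: "nat \<Rightarrow> (nat \<times> nat list) list \<Rightarrow> nat list" where
  "directory b as = map (array_start b as) [0..<length as] @ map fst as"

definition encode :: "nat \<Rightarrow> (nat \<times> nat list) list \<Rightarrow> bool list" where
  "encode b as = replicate b True @ [False] @ nat_bits (Suc b) b @
     array_bits (b, directory b as) @ concat (map array_bits as)"

definition unary_mask :: expr where
  "unary_mask = Bin BitXor (Fetch (Num 0)) (Bin Add (Fetch (Num 0)) (Num 1))"

definition field_width :: expr where
  "field_width = Bin Mod (Bin Div (Fetch (Num 0)) (Bin Add unary_mask (Num 1)))
      (Bin Add unary_mask (Num 1))"

definition read_directory :: "nat \<Rightarrow> expr" where
  "read_directory j = read_bits
     (Bin Add (Bin Add (Bin Add field_width field_width) (Num 2)) (Bin Mul (Num j) field_width))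
     field_width"

definition read_array :: "nat \<Rightarrow> nat \<Rightarrow> expr \<Rightarrow> expr" where
  "read_array c j e = read_bits
     (Bin Add (read_directory j) (Bin Mul e (read_directory (c + j)))) (read_directory (c + j))"

lemma length_encode:
  "length (encode b as) = 2 * b + 2 + 2 * length as * b + (\<Sum>a\<leftarrow>as. length (snd a) * fst a)"
proof -
  have "length (array_bits a) = length (snd a) * fst a" for a
    by (cases a) simp
  then show ?thesis
    by (simp add: encode_def directory_def length_concat comp_def add_mult_distrib)
qed

lemma bit_exp_minus_1: "bit (2 ^ b - 1 :: nat) j \<longleftrightarrow> j < b"
  using bit_mask_iff[where 'a = nat, of b j] by (simp add: mask_eq_exp_minus_1)

lemma eval_unary_mask:
  assumes "holds_bits w (encode b as) M" "2 * b + 2 \<le> w"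
  shows "expr_value w M x unary_mask = 2 ^ Suc b - 1" "expr_value w M x field_width = b"
proof -
  let ?D = "encode b as" and ?z = "M 0"
  have len: "2 * b + 2 \<le> length ?D" by (simp add: length_encode)
  have "0 * w < length ?D" using len by linarith
  then have "?z = horner_sum of_bool 2 (take w (drop (0 * w) ?D))"
    using assms(1) unfolding holds_bits_def by blast
  then have z: "?z = horner_sum of_bool 2 (take w ?D)" by simp
  have bz: "bit ?z j = ?D ! j" if "j < 2 * b + 2" for j
    unfolding z using that len assms(2) by (simp add: bit_horner_sum_bit_iff)
  define y where "y = drop_bit (Suc b) ?z"
  have t1: "take_bit (Suc b) ?z = 2 ^ b - 1"
  proof (rule bit_eqI)
    fix j
    show "bit (take_bit (Suc b) ?z) j = bit (2 ^ b - 1 :: nat) j"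
      unfolding bit_exp_minus_1 using bz[of j]
      by (cases j b rule: linorder_cases) (auto simp: bit_take_bit_iff encode_def nth_append)
  qed
  have t2: "take_bit (Suc b) y = b"
  proof -
    have "take_bit (Suc b) y = horner_sum of_bool 2 (nat_bits (Suc b) b)"
    proof (rule bit_eqI)
      fix j
      show "bit (take_bit (Suc b) y) j = bit (horner_sum of_bool 2 (nat_bits (Suc b) b) :: nat) j"
        using bz[of "Suc b + j"]
        by (auto simp: bit_take_bit_iff encode_def nth_append y_def bit_drop_bit_eq
          bit_horner_sum_bit_iff nth_Cons' )
    qed
    then show ?thesis using less_exp[of b] by (simp add: horner_sum_nat_bits)
  qed
  have zy: "?z = push_bit (Suc b) y + (2 ^ b - 1)"
    using t1 bits_ident[of "Suc b" ?z] by (simp add: y_def)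
  have zlt: "?z < 2 ^ w" using assms(1) by (simp add: holds_bits_def)
  have z1: "?z + 1 = push_bit (Suc b) y + 2 ^ b" by (simp add: zy)
  have "?z + 1 < 2 ^ w"
  proof (rule ccontr)
    assume "\<not> ?z + 1 < 2 ^ w"
    then have "?z + 1 = 2 ^ w" using zlt by simp
    then have "take_bit (Suc b) (?z + 1) = 0" using assms(2)
      by (simp add: take_bit_eq_mod mod_eq_0_iff_dvd le_imp_power_dvd del: power_Suc)
    moreover have "take_bit (Suc b) (?z + 1) = 2 ^ b"
      unfolding z1 by (simp add: take_bit_eq_mod push_bit_eq_mult)
    ultimately show False by simp
  qed
  then have s: "take_bit w (Suc ?z) = Suc ?z" by (simp add: take_bit_nat_eq_self_iff)
  have x: "xor ?z (Suc ?z) = 2 ^ Suc b - 1"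
  proof (rule bit_eqI)
    fix j
    have a: "?z = or (push_bit (Suc b) y) (2 ^ b - 1)"
      unfolding zy by (rule disjunctive_add)
        (auto simp: bit_push_bit_iff bit_exp_minus_1 simp del: One_nat_def push_bit_Suc)
    have b: "Suc ?z = or (push_bit (Suc b) y) (2 ^ b)"
    proof -
      have "push_bit (Suc b) y + 2 ^ b = or (push_bit (Suc b) y) (2 ^ b)"
        by (rule disjunctive_add) (auto simp: bit_push_bit_iff bit_exp_iff simp del: push_bit_Suc)
      then show ?thesis using z1 by (simp del: push_bit_Suc)
    qed
    show "bit (xor ?z (Suc ?z)) j = bit (2 ^ Suc b - 1 :: nat) j"
      unfolding b unfolding a
      by (auto simp: bit_xor_iff bit_or_iff bit_push_bit_iff bit_exp_minus_1 bit_exp_iff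
         simp del: One_nat_def power_Suc push_bit_Suc)
  qed
  have w1: "take_bit w (Suc 0) = Suc 0" using assms(2) by (simp add: take_bit_nat_eq_self_iff)
  show m: "expr_value w M x unary_mask = 2 ^ Suc b - 1"
    using x s assms(2) by (simp add: unary_mask_def w1)
  have e: "take_bit w (2 ^ Suc b :: nat) = 2 ^ Suc b"
    using assms(2) by (simp add: take_bit_nat_eq_self_iff del: power_Suc)
  have "expr_value w M x (Bin Add unary_mask (Num 1)) = 2 ^ Suc b"
    using m w1 e by simp
  then have "expr_value w M x field_width = ?z div 2 ^ Suc b mod 2 ^ Suc b"
    unfolding field_width_def expr_value.simps eval_binop.simps by simp
  then show "expr_value w M x field_width = b"
    using t2 by (simp add: y_def take_bit_eq_mod drop_bit_eq_div)
qed

lemma eval_Num: "a < 2 ^ w \<Longrightarrow> expr_value w M x (Num a) = a"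
  by (simp add: take_bit_nat_eq_self_iff)

lemma eval_Add:
  "expr_value w M x a = u \<Longrightarrow> expr_value w M x b = v \<Longrightarrow> u + v < 2 ^ w \<Longrightarrow> expr_value w M x (Bin Add a b) = u + v"
  by (simp add: take_bit_nat_eq_self_iff)

lemma eval_Mul:
  "expr_value w M x a = u \<Longrightarrow> expr_value w M x b = v \<Longrightarrow> u * v < 2 ^ w \<Longrightarrow> expr_value w M x (Bin Mul a b) = u * v"
  by (simp add: take_bit_nat_eq_self_iff)

lemma eval_read_directory:
  assumes D: "holds_bits w (encode b as) M" and w: "2 * b + 2 \<le> w"
    and len: "length (encode b as) < 2 ^ b"
    and j: "j < 2 * length as" and v: "directory b as ! j < 2 ^ b"
  shows "expr_value w M x (read_directory j) = directory b as ! j"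
proof -
  have b0: "0 < b" using len by (cases b) (simp_all add: length_encode)
  have bw: "(2 :: nat) ^ b < 2 ^ w" using w by simp
  note b = eval_unary_mask(2)[OF D w, of x]
  have "j * b \<le> 2 * length as * b" using j by (intro mult_right_mono) auto
  then have lt: "2 * b + 2 + j * b < 2 ^ w"
    using len bw unfolding length_encode by linarith
  have jb: "j \<le> j * b" using b0 by (cases b) simp_all
  show ?thesis
    unfolding read_directory_def
  proof (rule eval_read_array[OF D])
    show "encode b as = (replicate b True @ [False] @ nat_bits (Suc b) b) @
       array_bits (b, directory b as) @ concat (map array_bits as)"
      by (simp add: encode_def)
    show "expr_value w M x (Bin Add (Bin Add (Bin Add field_width field_width) (Num 2))
        (Bin Mul (Num j) field_width)) =
       length (replicate b True @ [False] @ nat_bits (Suc b) b) + j * b"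
    proof -
      have "expr_value w M x (Bin Add (Bin Add field_width field_width) (Num 2)) = b + b + 2"
        using lt by (intro eval_Add eval_Num b) linarith+
      moreover have "expr_value w M x (Bin Mul (Num j) field_width) = j * b"
        using lt jb by (intro eval_Mul eval_Num b) linarith+
      ultimately have "expr_value w M x (Bin Add (Bin Add (Bin Add field_width field_width) (Num 2))
          (Bin Mul (Num j) field_width)) = (b + b + 2) + j * b"
        using lt by (intro eval_Add[where u = "b + b + 2"]) simp_all
      then show ?thesis by simp
    qed
    show "length (encode b as) < 2 ^ w" using len bw by linarith
  qed (use b b0 w j v in \<open>simp_all add: directory_def\<close>)
qed

lemma eval_read_array_encode:
  assumes D: "holds_bits w (encode b as) M" and w: "2 * b + 2 \<le> w"
    and len: "length (encode b as) < 2 ^ b"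
    and j: "j < length as" and d: "fst (as ! j) \<le> b" "0 < fst (as ! j)"
    and e: "expr_value w M x e = i" and i: "i < length (snd (as ! j))"
    and v: "snd (as ! j) ! i < 2 ^ fst (as ! j)" and c: "c = length as"
  shows "expr_value w M x (read_array c j e) = snd (as ! j) ! i"
proof -
  obtain d xs where aj: "as ! j = (d, xs)" by fastforce
  let ?pre = "replicate b True @ [False] @ nat_bits (Suc b) b @ array_bits (b, directory b as)
     @ concat (map array_bits (take j as))"
  have split: "as = take j as @ as ! j # drop (Suc j) as"
    using j by (rule id_take_nth_drop)
  have D': "encode b as = ?pre @ array_bits (d, xs) @ concat (map array_bits (drop (Suc j) as))"
    unfolding encode_def
    by (subst (2) split) (simp add: aj)
  have start: "length ?pre = array_start b as j"
    by (simp add: array_start_def directory_def)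
  have bw: "(2 :: nat) ^ b < 2 ^ w" using w by simp
  have "Suc i * d \<le> length xs * d" using i aj by (intro mult_right_mono) auto
  then have lt: "array_start b as j + i * d < length (encode b as)"
    unfolding D' length_append[of ?pre] start using d aj by simp
  have dir: "directory b as ! j = array_start b as j" "directory b as ! (c + j) = d"
    using j aj c by (simp_all add: directory_def nth_append)
  have d1: "expr_value w M x (read_directory j) = array_start b as j"
    using eval_read_directory[OF D w len, of j x] dir j lt len by simp
  have "d < 2 ^ b" using d aj less_exp[of b] by (auto intro: le_less_trans)
  then have d2: "expr_value w M x (read_directory (c + j)) = d"
    using eval_read_directory[OF D w len, of "c + j" x] dir j c by simp
  have "expr_value w M x (read_array c j e) = xs ! i"
    unfolding read_array_def
  proof (rule eval_read_array[OF D D'])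
    show "expr_value w M x (Bin Add (read_directory j) (Bin Mul e (read_directory (c + j))))
        = length ?pre + i * d"
      unfolding start using lt len bw by (intro eval_Add eval_Mul d1 d2 e) linarith+
    show "length (encode b as) < 2 ^ w" using len bw by linarith
  qed (use d2 d i v w aj in simp_all)
  then show ?thesis by (simp add: aj)
qed

section \<open>Noncrossing forests\<close>

fun stack :: "(nat \<Rightarrow> bool) \<Rightarrow> (nat \<Rightarrow> bool) \<Rightarrow> nat \<Rightarrow> nat list" where
  "stack A L 0 = []"
| "stack A L (Suc d) = (if A d then [d] else []) @ (if L d then tl (stack A L d) else stack A L d)"

lemma upt_split_at:
  assumes "y < d" shows "[0..<d] = [0..<y] @ y # [Suc y..<d]"
  using upt_add_eq_append[of 0 y "d - y"] assms by (simp add: upt_conv_Cons)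

lemma rev_filter_upt_nth:
  assumes "Q y" "y < d"
  shows "rev (filter Q [0..<d]) ! card {z. y < z \<and> z < d \<and> Q z} = y"
proof -
  have u: "[0..<d] = [0..<y] @ y # [Suc y..<d]"
    using assms(2) by (rule upt_split_at)
  have "length (filter Q [Suc y..<d]) = card {z. y < z \<and> z < d \<and> Q z}"
    using distinct_card[of "filter Q [Suc y..<d]"]
    by (simp add: Suc_le_eq conj_commute conj_left_commute)
  then have l: "length (rev (filter Q [Suc y..<d])) = card {z. y < z \<and> z < d \<and> Q z}"
    by simp
  have r: "rev (filter Q [0..<d]) = rev (filter Q [Suc y..<d]) @ y # rev (filter Q [0..<y])"
    unfolding u using assms(1) by simp
  show ?thesis unfolding r by (simp add: nth_append l del: length_rev)
qed

locale forest =
  fixes p :: "nat \<Rightarrow> nat"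
  assumes parent_0: "p 0 = 0"
    and parent_less: "0 < i \<Longrightarrow> p i < i"
    and noncrossing: "0 < i \<Longrightarrow> i < i' \<Longrightarrow> p i < p i' \<Longrightarrow> i \<le> p i'"
begin

lemma parent_le: "p i \<le> i"
  using parent_0 parent_less[of i] by (cases "i = 0") auto

definition open_at :: "nat \<Rightarrow> nat \<Rightarrow> bool" where
  "open_at i j \<longleftrightarrow> (\<exists>c\<ge>i. 0 < c \<and> p c = j)"

definition has_child :: "nat \<Rightarrow> bool" where
  "has_child j \<longleftrightarrow> (\<exists>c>0. p c = j)"

definition last_child :: "nat \<Rightarrow> bool" where
  "last_child i \<longleftrightarrow> (\<forall>c>i. p c \<noteq> p i)"

lemma open_at_Suc_self: "open_at (Suc i) i \<longleftrightarrow> has_child i"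
  unfolding open_at_def has_child_def using parent_less by (metis Suc_leI less_Suc_eq_0_disj zero_less_Suc)

lemma not_last_child_0: "\<not> last_child 0"
  using parent_less[of 1] parent_0 by (auto simp: last_child_def)

lemma open_at_Suc: "open_at (Suc i) j \<longleftrightarrow> open_at i j \<and> \<not> (j = p i \<and> last_child i)"
proof (cases "i = 0")
  case True
  then show ?thesis using not_last_child_0 by (auto simp: open_at_def Suc_le_eq)
next
  case False
  have "open_at i j \<longleftrightarrow> p i = j \<or> (\<exists>c>i. p c = j)"
    unfolding open_at_def using False by (auto simp: le_less)
  moreover have "open_at (Suc i) j \<longleftrightarrow> (\<exists>c>i. p c = j)"
    unfolding open_at_def by (auto simp: Suc_le_eq)
  ultimately show ?thesis by (auto simp: last_child_def)
qed

lemma open_at_le_parent: "open_at i j \<Longrightarrow> j < i \<Longrightarrow> j \<le> p i"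
  unfolding open_at_def
  by (metis gr_zeroI le_less noncrossing not_less parent_0)

lemma stack_eq:
  assumes A: "\<And>d. d < s \<Longrightarrow> A d \<longleftrightarrow> has_child (a + d)"
    and L: "\<And>d. d < s \<Longrightarrow> L d \<longleftrightarrow> last_child (a + d)"
  shows "d \<le> s \<Longrightarrow> stack A L d = rev (filter (\<lambda>j. open_at (a + d) (a + j)) [0..<d])"
proof (induction d)
  case 0
  then show ?case by simp
next
  case (Suc d)
  let ?i = "a + d"
  let ?Q = "\<lambda>j. open_at ?i (a + j)" and ?Q' = "\<lambda>j. open_at (Suc ?i) (a + j)"
  have IH: "stack A L d = rev (filter ?Q [0..<d])" using Suc by simp
  have top: "?Q' d \<longleftrightarrow> A d" using Suc.prems A by (simp add: open_at_Suc_self)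
  have Ld: "L d \<longleftrightarrow> last_child ?i" using Suc.prems L by simp
  have rest: "rev (filter ?Q' [0..<d]) = (if L d then tl (stack A L d) else stack A L d)"
  proof (cases "last_child ?i")
    case False
    then show ?thesis using IH Ld by (simp add: open_at_Suc)
  next
    case True
    have le: "a + j \<le> p ?i" if "?Q j" "j < d" for j
      using open_at_le_parent[OF that(1)] that(2) by simp
    show ?thesis
    proof (cases "p ?i < a")
      case True
      have none: "\<not> ?Q j" if "j < d" for j using le[OF _ that] True by force
      then have "filter ?Q [0..<d] = []" "filter ?Q' [0..<d] = []"
        by (auto simp: filter_empty_conv open_at_Suc)
      then show ?thesis using IH by simp
    next
      case False
      then obtain y where y: "p ?i = a + y" by (metis le_iff_add not_less)
      have "?i \<noteq> 0" using True not_last_child_0 by metis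
      then have i0: "0 < ?i" by simp
      then have yd: "y < d" using parent_less[of ?i] y by simp
      have u: "[0..<d] = [0..<y] @ y # [Suc y..<d]"
        using yd by (rule upt_split_at)
      have Qy: "?Q y" unfolding open_at_def using i0 y by auto
      have above: "\<not> ?Q j" if "y < j" "j < d" for j using le[of j] that y by auto
      have f0: "filter ?Q [Suc y..<d] = []" "filter ?Q' [Suc y..<d] = []"
        using above by (auto simp: filter_empty_conv open_at_Suc)
      have f1: "filter ?Q' [0..<y] = filter ?Q [0..<y]"
        using y by (intro filter_cong) (auto simp: open_at_Suc)
      have "\<not> ?Q' y" using True y by (simp add: open_at_Suc)
      then show ?thesis
        unfolding IH u using f0 f1 Qy True Ld by simp
    qed
  qed
  show ?case using top rest by simp
qed

context
  fixes s a :: nat and A L :: "nat \<Rightarrow> bool"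
  assumes A: "\<And>d. d < s \<Longrightarrow> A d \<longleftrightarrow> has_child (a + d)"
    and L: "\<And>d. d < s \<Longrightarrow> L d \<longleftrightarrow> last_child (a + d)"
begin

lemma stack_far: "d < s \<Longrightarrow> p (a + d) < a \<Longrightarrow> stack A L d = []"
  using stack_eq[of s A a L d, OF A L] open_at_le_parent[of "a + d"]
  by (fastforce simp: filter_empty_conv)

lemma stack_near:
  assumes "d < s" "0 < a + d" "a \<le> p (a + d)"
  shows "stack A L d \<noteq> []" "a + hd (stack A L d) = p (a + d)"
proof -
  let ?Q = "\<lambda>j. open_at (a + d) (a + j)"
  obtain y where y: "p (a + d) = a + y" using assms(3) by (metis le_iff_add)
  have yd: "y < d" using parent_less[of "a + d"] assms(2) y by simp
  have u: "[0..<d] = [0..<y] @ y # [Suc y..<d]"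
    using yd by (rule upt_split_at)
  have Qy: "?Q y" unfolding open_at_def using assms(2) y by auto
  have "\<not> ?Q j" if "y < j" "j < d" for j using open_at_le_parent[of "a + d" "a + j"] that y by auto
  then have f0: "filter ?Q [Suc y..<d] = []" by (auto simp: filter_empty_conv)
  have "stack A L d = y # rev (filter ?Q [0..<y])"
    using stack_eq[of s A a L d, OF A L] assms(1) Qy f0 unfolding u by simp
  then show "stack A L d \<noteq> []" "a + hd (stack A L d) = p (a + d)" using y by simp_all
qed

lemma stack_final:
  assumes "open_at (a + s) (a + y)" "y < s"
  shows "stack A L s ! card {j. a + y < j \<and> j < a + s \<and> open_at (a + s) j} = y"
proof -
  have "{j. a + y < j \<and> j < a + s \<and> open_at (a + s) j} =
     (+) a ` {z. y < z \<and> z < s \<and> open_at (a + s) (a + z)}"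
    by (auto simp: image_iff) (metis add_diff_inverse_nat add_lessD1 less_diff_conv2
       less_imp_le_nat nat_add_left_cancel_less not_less_iff_gr_or_eq order_less_trans trans_less_add1)
  then have "card {j. a + y < j \<and> j < a + s \<and> open_at (a + s) j} =
     card {z. y < z \<and> z < s \<and> open_at (a + s) (a + z)}"
    by (simp add: card_image)
  then show ?thesis
    using stack_eq[of s A a L s, OF A L]
      rev_filter_upt_nth[of "\<lambda>z. open_at (a + s) (a + z)" y s, OF assms] by simp
qed

end

definition first_edge :: "nat \<Rightarrow> nat \<Rightarrow> bool" where
  "first_edge s i \<longleftrightarrow> (\<forall>i'<i. i' div s = i div s \<longrightarrow> p i' div s \<noteq> p i div s)"

definition pioneer :: "nat \<Rightarrow> nat \<Rightarrow> bool" where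
  "pioneer s i \<longleftrightarrow> p i div s < i div s \<and> first_edge s i"

lemma first_edge_exists:
  "\<exists>g\<le>i. g div s = i div s \<and> p g div s = p i div s \<and> first_edge s g"
proof -
  let ?G = "\<lambda>i'. i' \<le> i \<and> i' div s = i div s \<and> p i' div s = p i div s"
  define g where "g = (LEAST i'. ?G i')"
  have g: "?G g" unfolding g_def by (rule LeastI[of ?G i]) simp
  have "first_edge s g"
    unfolding first_edge_def
  proof (intro allI impI)
    fix i' assume i': "i' < g" "i' div s = g div s"
    then have "\<not> ?G i'" using not_less_Least[of i' ?G] by (simp add: g_def)
    then show "p i' div s \<noteq> p g div s" using g i' by auto
  qed
  with g show ?thesis by blast
qed

definition stack_index :: "nat \<Rightarrow> nat \<Rightarrow> nat" where
  "stack_index s i =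
     (let e = Suc (p i div s) * s in card {j. p i < j \<and> j < e \<and> open_at e j})"

lemma far_antimono:
  assumes "i \<le> i'" "i div s = i' div s" "p i div s < i div s" "p i' div s < i' div s"
  shows "p i' \<le> p i"
proof (rule ccontr)
  assume "\<not> p i' \<le> p i"
  then have "i < i'" "p i < p i'" using assms(1) by (auto simp: le_less)
  moreover have "0 < i" using assms(3) by (cases i) auto
  ultimately have "i \<le> p i'" using noncrossing by blast
  then show False using div_le_mono[of i "p i'" s] assms by simp
qed

lemma last_pioneer:
  assumes "p i div s < i div s"
  defines "f \<equiv> Max {i'. i' \<le> i \<and> i' div s = i div s \<and> pioneer s i'}"
  shows "f \<le> i" "f div s = i div s" "pioneer s f" "p f div s = p i div s"
proof -
  let ?F = "{i'. i' \<le> i \<and> i' div s = i div s \<and> pioneer s i'}"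
  obtain g where g: "g \<le> i" "g div s = i div s" "p g div s = p i div s" "first_edge s g"
    using first_edge_exists by blast
  then have "pioneer s g" using assms(1) by (simp add: pioneer_def)
  then have gF: "g \<in> ?F" using g by simp
  have fin: "finite ?F" by simp
  have fF: "f \<in> ?F" unfolding f_def using Max_in[OF fin] gF by blast
  have gf: "g \<le> f" unfolding f_def using Max_ge[OF fin gF] .
  show f: "f \<le> i" "f div s = i div s" "pioneer s f" using fF by auto
  have far: "p f div s < f div s" using f(3) by (simp add: pioneer_def)
  have "p f \<le> p g" using far_antimono[OF gf, of s] g f far assms(1) by simp
  moreover have "p i \<le> p f" using far_antimono[OF f(1,2) far assms(1)] .
  ultimately show "p f div s = p i div s"
    using g div_le_mono[of "p f" "p g" s] div_le_mono[of "p i" "p f" s] by simp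
qed

lemma stack_index_shift:
  assumes s: "0 < s" and "f \<le> i" "f div s = i div s" "p f div s = p i div s"
    and far: "p i div s < i div s"
  shows "stack_index s i = stack_index s f +
     card {i'. f \<le> i' \<and> i' < i \<and> p i' div s < i div s \<and> last_child i'}"
proof -
  define e where "e = Suc (p i div s) * s"
  let ?J = "\<lambda>u v. {j. u < j \<and> j \<le> v \<and> open_at e j}"
  let ?K = "{i'. f \<le> i' \<and> i' < i \<and> p i' div s < i div s \<and> last_child i'}"
  have pe: "j < e \<longleftrightarrow> j div s \<le> p i div s" for j
    unfolding e_def using s by (simp add: less_mult_imp_div_less div_less_iff_less_mult flip: less_Suc_eq_le)
  have fe: "e \<le> f" 
    unfolding not_less[symmetric] pe using far assms(3) by simp
  have pif: "p i \<le> p f" using far_antimono[OF assms(2,3)] assms(3,4) far by simp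
  have pfe: "p f < e" using pe assms(4) by simp
  have f0: "0 < f" using assms(3) far by (cases f) auto
  have K: "bij_betw p ?K (?J (p i) (p f))"
    unfolding bij_betw_def
  proof
    show "inj_on p ?K"
    proof (rule inj_onI)
      fix x y assume "x \<in> ?K" "y \<in> ?K" "p x = p y"
      then show "x = y" by (metis (mono_tags, lifting) last_child_def linorder_neqE_nat mem_Collect_eq)
    qed
    show "p ` ?K = ?J (p i) (p f)"
    proof (intro equalityI subsetI)
      fix j assume "j \<in> p ` ?K"
      then obtain c where c: "j = p c" "f \<le> c" "c < i" "p c div s < i div s" "last_child c" by auto
      have cd: "c div s = i div s"
        using div_le_mono[of f c s] div_le_mono[of c i s] c assms(3) by simp
      have "p i \<le> p c" using far_antimono[of c i s] c cd far by simp
      moreover have "p i \<noteq> p c" using c by (auto simp: last_child_def)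
      moreover have "p c \<le> p f" using far_antimono[of f c s] c cd assms(3,4) far by simp
      moreover have "open_at e j" unfolding open_at_def using c fe f0 by (intro exI[of _ c]) auto
      ultimately show "j \<in> ?J (p i) (p f)" using c by simp
    next
      fix j assume j: "j \<in> ?J (p i) (p f)"
      then obtain c0 where c0: "e \<le> c0" "0 < c0" "p c0 = j" by (auto simp: open_at_def)
      let ?C = "{c. e \<le> c \<and> p c = j}"
      have ci: "c < i" if "c \<in> ?C" for c
      proof (rule ccontr)
        assume "\<not> c < i"
        moreover have "c \<noteq> i" using that j by auto
        ultimately have "i \<le> j"
          using noncrossing[of i c] that j f0 assms(2) by auto
        then show False using j pfe fe assms(2) by auto
      qed
      then have fin: "finite ?C" by (meson finite_nat_set_iff_bounded)
      define c where "c = Max ?C"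
      have c: "c \<in> ?C" unfolding c_def by (rule Max_in[OF fin]) (use c0 in auto)
      have cm: "c' \<le> c" if "c' \<in> ?C" for c' unfolding c_def using Max_ge[OF fin that] .
      have "last_child c"
        unfolding last_child_def
      proof (intro allI impI notI)
        fix c' assume "c < c'" "p c' = p c"
        then show False using cm[of c'] c by auto
      qed
      moreover have "f \<le> c"
      proof (cases "j = p f")
        case True
        then show ?thesis using cm[of f] fe by simp
      next
        case False
        then have "p c < p f" using j c by auto
        show ?thesis
        proof (rule ccontr)
          assume "\<not> f \<le> c"
          moreover have "0 < c" using c pfe by (cases c) auto
          ultimately have "c \<le> p f" using noncrossing[of c f] \<open>p c < p f\<close> by auto
          then show False using c pfe by simp
        qed
      qed
      moreover have "p c div s < i div s"
        using j c pfe pe[of "p c"] far by auto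
      ultimately show "j \<in> p ` ?K" using ci[OF c] c by (intro image_eqI[of _ _ c]) auto
    qed
  qed
  have "{j. p i < j \<and> j < e \<and> open_at e j} =
      ?J (p i) (p f) \<union> {j. p f < j \<and> j < e \<and> open_at e j}"
    using pif pfe by auto
  moreover have "card (?J (p i) (p f) \<union> {j. p f < j \<and> j < e \<and> open_at e j}) =
     card (?J (p i) (p f)) + card {j. p f < j \<and> j < e \<and> open_at e j}"
    by (rule card_Un_disjoint) auto
  ultimately show ?thesis
    using bij_betw_same_card[OF K] unfolding stack_index_def Let_def assms(4) e_def[symmetric]
    by simp
qed

lemma stack_index_less:
  assumes "0 < s" shows "stack_index s i < s"
proof -
  let ?e = "Suc (p i div s) * s"
  have "{j. p i < j \<and> j < ?e \<and> open_at ?e j} \<subseteq> {Suc (p i)..<?e}" by auto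
  then have "stack_index s i \<le> ?e - Suc (p i)"
    unfolding stack_index_def Let_def by (metis card_atLeastLessThan card_mono finite_atLeastLessThan)
  moreover have "p i div s * s \<le> p i" by (rule div_times_less_eq_dividend)
  ultimately show ?thesis using assms unfolding mult_Suc by linarith
qed

definition block_edges :: "nat \<Rightarrow> nat \<Rightarrow> (nat \<times> nat) set" where
  "block_edges s n = (\<lambda>i. (i div s, p i div s)) ` {..n}"

lemma card_block_edges: "card (block_edges s n) \<le> 3 * Suc (n div s)"
proof -
  let ?E = "block_edges s n" and ?N = "{..n div s}"
  let ?min = "\<lambda>B B'. \<forall>B''. (B, B'') \<in> ?E \<longrightarrow> B' \<le> B''"
  let ?Diag = "{(B, B') \<in> ?E. B = B'}"
  let ?Low = "{(B, B') \<in> ?E. ?min B B'}"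
  let ?Rest = "{(B, B') \<in> ?E. B \<noteq> B' \<and> \<not> ?min B B'}"
  have le: "B' \<le> B" "B \<le> n div s" if "(B, B') \<in> ?E" for B B'
    using that parent_le by (auto simp: block_edges_def intro: div_le_mono)
  have d: "card ?Diag \<le> card ?N"
    by (rule card_inj_on_le[where f = fst]) (use le in \<open>auto simp: inj_on_def\<close>)
  have l: "card ?Low \<le> card ?N"
    by (rule card_inj_on_le[where f = fst]) (use le in \<open>auto simp: inj_on_def intro: antisym\<close>)
  have r: "card ?Rest \<le> card ?N"
  proof (rule card_inj_on_le[where f = snd])
    have no: False if B: "(B, B') \<in> ?Rest" and C: "(C, B') \<in> ?Rest" and "B < C" for B C B'
    proof -
      obtain B'' where B'': "(B, B'') \<in> ?E" "B'' < B'" using B by (auto simp: not_le)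
      have edge: "\<exists>i. D = i div s \<and> D' = p i div s" if "(D, D') \<in> ?E" for D D'
        using that by (auto simp: block_edges_def)
      obtain i where i: "B = i div s" "B'' = p i div s" using edge[OF B''(1)] by blast
      obtain c where c: "C = c div s" "B' = p c div s" using edge[of C B'] C by blast
      have "B' < B" using B le[of B B'] by auto
      then have "0 < i" using i by (cases i) auto
      moreover have "i < c" using \<open>B < C\<close> i c by (meson div_le_mono not_less)
      moreover have "p i < p c" using B''(2) i c by (meson div_le_mono not_less)
      ultimately have "i \<le> p c" using noncrossing by blast
      then show False using div_le_mono[of i "p c" s] i c \<open>B' < B\<close> by simp
    qed
    show "inj_on snd ?Rest"
    proof (rule inj_onI)
      fix x y assume "x \<in> ?Rest" "y \<in> ?Rest" "snd x = snd y"
      moreover obtain B B' C C' where "x = (B, B')" "y = (C, C')" by fastforce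
      ultimately have x: "(B, B') \<in> ?Rest" and y: "(C, B') \<in> ?Rest" and "x = (B, B')" "y = (C, B')"
        by simp_all
      then show "x = y" using no[OF x y] no[OF y x] by (metis linorder_neqE_nat)
    qed
    show "snd ` ?Rest \<subseteq> ?N" using le by fastforce
  qed simp
  have "?E = (?Diag \<union> ?Low) \<union> ?Rest" by auto
  then have "card ?E = card ((?Diag \<union> ?Low) \<union> ?Rest)" by (rule arg_cong)
  also have "\<dots> \<le> card ?Diag + card ?Low + card ?Rest"
    by (meson add_le_mono1 card_Un_le order_trans)
  also have "\<dots> \<le> card ?N + card ?N + card ?N" by (intro add_mono d l r)
  also have "\<dots> = 3 * Suc (n div s)" by simp
  finally show ?thesis .
qed

lemma card_first_edges: "card {i. i \<le> n \<and> first_edge s i} \<le> 3 * Suc (n div s)"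
proof -
  have "card {i. i \<le> n \<and> first_edge s i} \<le> card (block_edges s n)"
  proof (rule card_inj_on_le[where f = "\<lambda>i. (i div s, p i div s)"])
    show "inj_on (\<lambda>i. (i div s, p i div s)) {i. i \<le> n \<and> first_edge s i}"
      unfolding inj_on_def first_edge_def by (auto, metis linorder_neqE_nat)
  qed (auto simp: block_edges_def)
  also have "\<dots> \<le> 3 * Suc (n div s)" by (rule card_block_edges)
  finally show ?thesis .
qed

lemma length_first_edges:
  assumes "0 < s"
  shows "length (filter (first_edge s) [0..<Suc N * s]) \<le> 3 * Suc N"
proof -
  have "length (filter (first_edge s) [0..<Suc N * s]) = card (set (filter (first_edge s) [0..<Suc N * s]))"
    by (intro distinct_card[symmetric] distinct_filter distinct_upt)
  also have "set (filter (first_edge s) [0..<Suc N * s]) = {i. i \<le> Suc N * s - 1 \<and> first_edge s i}"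
    using assms by (auto simp: less_eq_Suc_le)
  also have "card \<dots> \<le> 3 * Suc ((Suc N * s - 1) div s)" by (rule card_first_edges)
  also have "(Suc N * s - 1) div s = N"
    using assms by (intro div_nat_eqI) (auto simp: mult.commute)
  finally show ?thesis .
qed

end

section \<open>The encoding of a forest\<close>

definition row_log :: "nat \<Rightarrow> nat" where
  "row_log n = floor_log (n + 2)"

definition block_size :: "nat \<Rightarrow> nat" where
  "block_size n = row_log n div 8 + 1"

definition superblock_size :: "nat \<Rightarrow> nat" where
  "superblock_size n = block_size n * row_log n"

definition short_width :: "nat \<Rightarrow> nat" where
  "short_width n = Suc (floor_log (superblock_size n))"

definition long_width :: "nat \<Rightarrow> nat" where
  "long_width n = 20 * row_log n"

lemma horner_sum_bits_less: "horner_sum of_bool 2 bs < (2 :: nat) ^ length bs"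
proof (induction bs)
  case (Cons b bs)
  then show ?case by (cases b) simp_all
qed simp

lemma filter_upt_nth:
  assumes "Q y" "y < d"
  shows "filter Q [0..<d] ! card {z. z < y \<and> Q z} = y"
    and "card {z. z < y \<and> Q z} < length (filter Q [0..<d])"
proof -
  have "length (filter Q [0..<y]) = card {z. z < y \<and> Q z}"
    using distinct_card[of "filter Q [0..<y]"] by (simp add: conj_commute)
  then show "filter Q [0..<d] ! card {z. z < y \<and> Q z} = y"
    "card {z. z < y \<and> Q z} < length (filter Q [0..<d])"
    unfolding upt_split_at[OF assms(2)] using assms(1) by (simp_all add: nth_append)
qed

lemma card_less_add:
  assumes "a \<le> y"
  shows "card {z. z < y \<and> Q z} = card {z. z < a \<and> Q z} + card {z. a \<le> z \<and> z < y \<and> Q (z :: nat)}"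
proof -
  have "{z. z < y \<and> Q z} = {z. z < a \<and> Q z} \<union> {z. a \<le> z \<and> z < y \<and> Q z}"
    (is "?Y = ?A \<union> ?B") using assms by auto
  moreover have "card (?A \<union> ?B) = card ?A + card ?B"
    by (rule card_Un_disjoint) auto
  ultimately show ?thesis by (rule trans[OF arg_cong])
qed

lemma card_between_less:
  assumes "a \<le> y" "y < a + d" shows "card {z. a \<le> z \<and> z < y \<and> Q (z :: nat)} < d"
proof -
  have "card {z. a \<le> z \<and> z < y \<and> Q z} \<le> card {a..<y}"
    by (intro card_mono) auto
  also have "\<dots> < d" using assms by auto
  finally show ?thesis .
qed

text \<open>The number encoding a block carries four bits per position: whether the position has a
  child, whether it is a last child, whether it is a pioneer, and whether it is marked.\<close>

abbreviation code_stack :: "nat \<Rightarrow> nat \<Rightarrow> nat list" where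
  "code_stack X \<equiv> stack (\<lambda>d. bit X (4 * d)) (\<lambda>d. bit X (4 * d + 1))"

abbreviation code_pioneer :: "nat \<Rightarrow> nat \<Rightarrow> bool" where
  "code_pioneer X d \<equiv> bit X (4 * d + 2)"

definition lookup_far :: "nat \<Rightarrow> nat \<Rightarrow> nat" where
  "lookup_far X d = of_bool (code_stack X d = [])"

definition lookup_near :: "nat \<Rightarrow> nat \<Rightarrow> nat" where
  "lookup_near X d = hd (code_stack X d)"

definition lookup_rank :: "nat \<Rightarrow> nat \<Rightarrow> nat" where
  "lookup_rank X d = card {d'. d' < Max {f. f \<le> d \<and> code_pioneer X f} \<and> code_pioneer X d'}"

definition lookup_shift :: "nat \<Rightarrow> nat \<Rightarrow> nat" where
  "lookup_shift X d = card {d'. Max {f. f \<le> d \<and> code_pioneer X f} \<le> d' \<and> d' < d \<and>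
     code_stack X d' = [] \<and> bit X (4 * d' + 1)}"

definition lookup_mark :: "nat \<Rightarrow> nat \<Rightarrow> nat" where
  "lookup_mark X d = of_bool (bit X (4 * d + 3))"

definition lookup_table :: "nat \<Rightarrow> (nat \<Rightarrow> nat \<Rightarrow> nat) \<Rightarrow> nat list" where
  "lookup_table s f = map (\<lambda>t. f (t div s) (t mod s)) [0..<2 ^ (4 * s) * s]"

lemma lookup_table_nth:
  assumes "X < 2 ^ (4 * s)" "d < s"
  shows "X * s + d < length (lookup_table s f)" "lookup_table s f ! (X * s + d) = f X d"
proof -
  have "Suc X * s \<le> 2 ^ (4 * s) * s" using assms(1) by (intro mult_right_mono) auto
  then have lt: "X * s + d < 2 ^ (4 * s) * s" using assms(2) by simp
  then show "X * s + d < length (lookup_table s f)" by (simp add: lookup_table_def)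
  show "lookup_table s f ! (X * s + d) = f X d"
    using lt assms(2) by (simp add: lookup_table_def)
qed

locale marked_forest = forest p for p +
  fixes mark :: "nat \<Rightarrow> bool" and n :: nat
begin

abbreviation s :: nat where "s \<equiv> block_size n"
abbreviation g :: nat where "g \<equiv> row_log n"
abbreviation S :: nat where "S \<equiv> superblock_size n"

definition block_code :: "nat \<Rightarrow> nat" where
  "block_code a = horner_sum of_bool 2 (map (\<lambda>t.
     (let i = a + t div 4 in [has_child i, last_child i, pioneer s i, mark i]) ! (t mod 4)) [0..<4 * s])"

definition pioneer_count :: "nat \<Rightarrow> nat" where
  "pioneer_count x = card {i. i < x \<and> pioneer s i}"

definition super_count :: "nat \<Rightarrow> nat" where
  "super_count x = card {i. i < x \<and> first_edge S i}"

definition super_rank :: "nat \<Rightarrow> nat" where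
  "super_rank i = (let f = (LEAST f. f div S = i div S \<and> p f div S = p i div S)
     in card {z. i div S * S \<le> z \<and> z < f \<and> first_edge S z})"

definition pioneers :: "nat list" where
  "pioneers = filter (pioneer s) [0..<Suc (n div s) * s]"

definition super_edges :: "nat list" where
  "super_edges = filter (first_edge S) [0..<Suc (n div S) * S]"

definition arrays :: "(nat \<times> nat list) list" where
  "arrays =
    [(long_width n, [s, g]),
     (4 * s, map (\<lambda>b. block_code (b * s)) [0..<Suc (n div s)]),
     (long_width n, map (\<lambda>B. pioneer_count (B * S)) [0..<Suc (n div S)]),
     (short_width n, map (\<lambda>b. pioneer_count (b * s) - pioneer_count (b div g * S)) [0..<Suc (n div s)]),
     (short_width n, map super_rank pioneers),
     (short_width n, map (\<lambda>i. p i div s mod g) pioneers),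
     (short_width n, map (stack_index s) pioneers),
     (long_width n, map (\<lambda>B. super_count (B * S)) [0..<Suc (n div S)]),
     (long_width n, map (\<lambda>i. p i div S) super_edges),
     (short_width n, lookup_table s lookup_far),
     (short_width n, lookup_table s lookup_near),
     (short_width n, lookup_table s lookup_rank),
     (short_width n, lookup_table s lookup_shift),
     (short_width n, lookup_table s (\<lambda>X d. code_stack X s ! d)),
     (short_width n, lookup_table s lookup_mark)]"

definition forest_bits :: "bool list" where
  "forest_bits = encode (long_width n) arrays"

end

text \<open>The numerals below are positions in \<open>arrays\<close>, which has 15 elements.\<close>

abbreviation rd :: "nat \<Rightarrow> expr \<Rightarrow> expr" where
  "rd \<equiv> read_array 15"

definition length_expr :: expr where
  "length_expr = rd 0 (Num 0)"

definition factor_expr :: expr where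
  "factor_expr = rd 0 (Num 1)"

definition block_expr :: "expr \<Rightarrow> expr" where
  "block_expr x = Bin Div x length_expr"

definition super_expr :: "expr \<Rightarrow> expr" where
  "super_expr x = Bin Div (block_expr x) factor_expr"

definition code_expr :: "expr \<Rightarrow> expr" where
  "code_expr b = rd 1 b"

definition entry_expr :: "expr \<Rightarrow> expr \<Rightarrow> expr" where
  "entry_expr b d = Bin Add (Bin Mul (code_expr b) length_expr) d"

definition cell_expr :: "expr \<Rightarrow> expr" where
  "cell_expr x = entry_expr (block_expr x) (Bin Mod x length_expr)"

definition pioneer_expr :: "expr \<Rightarrow> expr" where
  "pioneer_expr x =
     Bin Add (Bin Add (rd 2 (super_expr x)) (rd 3 (block_expr x))) (rd 11 (cell_expr x))"

definition target_expr :: "expr \<Rightarrow> expr" where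
  "target_expr x =
     Bin Add
       (Bin Mul (rd 8 (Bin Add (rd 7 (super_expr x)) (rd 4 (pioneer_expr x)))) factor_expr)
       (rd 5 (pioneer_expr x))"

definition far_expr :: "expr \<Rightarrow> expr" where
  "far_expr x =
     Bin Add (Bin Mul (target_expr x) length_expr)
       (rd 13 (entry_expr (target_expr x)
         (Bin Add (rd 6 (pioneer_expr x)) (rd 12 (cell_expr x)))))"

definition near_expr :: "expr \<Rightarrow> expr" where
  "near_expr x = Bin Add (Bin Mul (block_expr x) length_expr) (rd 10 (cell_expr x))"

text \<open>Both alternatives are evaluated; the one that does not apply yields an arbitrary word and is
  multiplied by 0.\<close>

definition parent_expr :: expr where
  "parent_expr =
     Bin Add (Bin Mul (rd 9 (cell_expr Input)) (far_expr Input))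
       (Bin Mul (Bin Sub (Num 1) (rd 9 (cell_expr Input))) (near_expr Input))"

definition mark_expr :: expr where
  "mark_expr = rd 14 (cell_expr Input)"

lemma row_log_bounds: "0 < row_log n" "2 ^ row_log n \<le> n + 2" "n + 2 < 2 * 2 ^ row_log n"
proof -
  have "floor_log 2 \<le> floor_log (n + 2)" by (rule floor_log_le_iff) simp
  then show "0 < row_log n" using floor_log_power[of 1] by (simp add: row_log_def)
  show "2 ^ row_log n \<le> n + 2" unfolding row_log_def by (rule floor_log_exp2_le) simp
  show "n + 2 < 2 * 2 ^ row_log n" unfolding row_log_def by (rule floor_log_exp2_gt)
qed

lemma block_size_le: "0 < block_size n" "block_size n \<le> row_log n" 
  using row_log_bounds(1)[of n] by (simp_all add: block_size_def)

lemma superblock_size_pos: "0 < superblock_size n"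
  using row_log_bounds(1)[of n] block_size_le by (simp add: superblock_size_def)

lemma superblock_size_less: "superblock_size n < 2 ^ short_width n"
  using floor_log_exp2_gt[of "superblock_size n"] by (simp add: short_width_def)

lemma short_width_le: "short_width n \<le> 2 * row_log n"
proof -
  let ?q = "row_log n"
  have "superblock_size n \<le> ?q * ?q" using block_size_le by (simp add: superblock_size_def)
  also have "\<dots> < 2 ^ ?q * 2 ^ ?q" using less_exp[of ?q] by (intro mult_strict_mono) auto
  finally have S: "superblock_size n < 2 ^ (2 * ?q)" by (simp add: mult_2 power_add)
  have "2 ^ floor_log (superblock_size n) \<le> superblock_size n"
    using superblock_size_pos by (rule floor_log_exp2_le)
  then have "(2 :: nat) ^ floor_log (superblock_size n) < 2 ^ (2 * ?q)" using S by linarith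
  then have "floor_log (superblock_size n) < 2 * ?q" by simp
  then show ?thesis by (simp add: short_width_def)
qed

lemma n_less_long: "n < 2 ^ long_width n"
proof -
  have "n < 2 ^ Suc (row_log n)" using row_log_bounds(3)[of n] by simp
  also have "(2 :: nat) ^ Suc (row_log n) \<le> 2 ^ long_width n"
    using row_log_bounds(1)[of n] by (intro power_increasing) (auto simp: long_width_def)
  finally show ?thesis .
qed

context marked_forest
begin

lemma block_code_less: "block_code a < 2 ^ (4 * s)"
  using horner_sum_bits_less[of "map _ [0..<4 * s]"] by (simp add: block_code_def)

lemma bit_block_code:
  assumes "d < s"
  shows "bit (block_code a) (4 * d) \<longleftrightarrow> has_child (a + d)"
    and "bit (block_code a) (4 * d + 1) \<longleftrightarrow> last_child (a + d)"
    and "bit (block_code a) (4 * d + 2) \<longleftrightarrow> pioneer s (a + d)"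
    and "bit (block_code a) (4 * d + 3) \<longleftrightarrow> mark (a + d)"
proof -
  have bit: "bit (block_code a) t \<longleftrightarrow>
      (let i = a + t div 4 in [has_child i, last_child i, pioneer s i, mark i]) ! (t mod 4)"
    if "t < 4 * s" for t
    using that by (simp add: block_code_def bit_horner_sum_bit_iff)
  have "(4 * d) mod 4 = 0" "(4 * d + 1) mod 4 = 1" "(4 * d + 2) mod 4 = 2" "(4 * d + 3) mod 4 = 3"
    "(4 * d) div 4 = d" "(4 * d + 1) div 4 = d" "(4 * d + 2) div 4 = d" "(4 * d + 3) div 4 = d"
    by presburger+
  then show "bit (block_code a) (4 * d) \<longleftrightarrow> has_child (a + d)"
    "bit (block_code a) (4 * d + 1) \<longleftrightarrow> last_child (a + d)"
    "bit (block_code a) (4 * d + 2) \<longleftrightarrow> pioneer s (a + d)"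
    "bit (block_code a) (4 * d + 3) \<longleftrightarrow> mark (a + d)"
    using bit[of "4 * d"] bit[of "4 * d + 1"] bit[of "4 * d + 2"] bit[of "4 * d + 3"] assms
    by (simp_all add: Let_def del: One_nat_def)
qed

lemma length_pioneers: "length pioneers \<le> 3 * Suc (n div s)"
proof -
  have "pioneers = filter (\<lambda>i. p i div s < i div s) (filter (first_edge s) [0..<Suc (n div s) * s])"
    unfolding pioneers_def filter_filter by (rule filter_cong) (auto simp: pioneer_def)
  then show ?thesis
    using length_first_edges[OF block_size_le(1), of n "n div s"] length_filter_le
    by (metis (no_types, lifting) le_trans)
qed

lemma length_super_edges: "length super_edges \<le> 3 * Suc (n div S)"
  unfolding super_edges_def using length_first_edges superblock_size_pos by blast

end

section \<open>Computing parents\<close>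

context marked_forest
begin

lemma block_code_facts:
  assumes "d < s"
  shows "p (b * s + d) div s < b \<Longrightarrow> code_stack (block_code (b * s)) d = []"
    and "0 < b * s + d \<Longrightarrow> \<not> p (b * s + d) div s < b \<Longrightarrow>
      code_stack (block_code (b * s)) d \<noteq> [] \<and>
      b * s + hd (code_stack (block_code (b * s)) d) = p (b * s + d)"
  using stack_far[of s _ "b * s", OF bit_block_code(1,2)] stack_near[of s _ "b * s", OF bit_block_code(1,2)]
    assms block_size_le(1)[of n]
  by (simp_all add: div_less_iff_less_mult not_less less_eq_div_iff_mult_less_eq)

lemma lookup_far_eq:
  assumes "0 < x"
  shows "lookup_far (block_code (x div s * s)) (x mod s) = of_bool (p x div s < x div s)"
  using block_code_facts[of "x mod s" "x div s"] block_size_le(1)[of n] assms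
  by (auto simp: lookup_far_def)

lemma lookup_near_eq:
  assumes "0 < x" "\<not> p x div s < x div s"
  shows "x div s * s + lookup_near (block_code (x div s * s)) (x mod s) = p x"
  using block_code_facts(2)[of "x mod s" "x div s"] block_size_le(1)[of n] assms
  by (auto simp: lookup_near_def)

lemma lookup_mark_eq: "lookup_mark (block_code (x div s * s)) (x mod s) = of_bool (mark x)"
  using bit_block_code(4)[of "x mod s" "x div s * s"] block_size_le(1)[of n]
  by (simp add: lookup_mark_def)

definition last_pioneer_of :: "nat \<Rightarrow> nat" where
  "last_pioneer_of x = Max {i'. i' \<le> x \<and> i' div s = x div s \<and> pioneer s i'}"

context
  fixes x :: nat
  assumes far: "p x div s < x div s"
begin

lemmas last_pioneer_facts = last_pioneer[OF far, folded last_pioneer_of_def]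

lemma last_pioneer_of_eq:
  "last_pioneer_of x =
     x div s * s + Max {f. f \<le> x mod s \<and> code_pioneer (block_code (x div s * s)) f}"
proof -
  let ?a = "x div s * s"
  let ?F = "{f. f \<le> x mod s \<and> code_pioneer (block_code ?a) f}"
  have s0: "0 < s" by (rule block_size_le)
  have ms: "x mod s < s" using s0 by simp
  have "{i'. i' \<le> x \<and> i' div s = x div s \<and> pioneer s i'} = (+) ?a ` ?F"
  proof (intro equalityI subsetI)
    fix i assume i: "i \<in> {i'. i' \<le> x \<and> i' div s = x div s \<and> pioneer s i'}"
    then have e: "i = ?a + i mod s" by (metis (mono_tags, lifting) div_mult_mod_eq mem_Collect_eq)
    have "i mod s \<le> x mod s" using i e div_mult_mod_eq[of x s] by (metis (mono_tags, lifting) add_le_cancel_left mem_Collect_eq)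
    then show "i \<in> (+) ?a ` ?F"
      using i e bit_block_code(3)[of "i mod s" ?a] s0 by (intro image_eqI[of _ _ "i mod s"]) auto
  next
    fix i assume "i \<in> (+) ?a ` ?F"
    then obtain d where d: "i = ?a + d" "d \<le> x mod s" "code_pioneer (block_code ?a) d" by auto
    have ds: "d < s" using d(2) ms by simp
    have "i \<le> x" using d div_mult_mod_eq[of x s] by linarith
    moreover have "i div s = x div s" using d(1) ds by simp
    ultimately show "i \<in> {i'. i' \<le> x \<and> i' div s = x div s \<and> pioneer s i'}"
      using d bit_block_code(3)[OF ds, of ?a] by simp
  qed
  moreover have "last_pioneer_of x \<in> {i'. i' \<le> x \<and> i' div s = x div s \<and> pioneer s i'}"
    using last_pioneer_facts by simp
  ultimately have eq: "{i'. i' \<le> x \<and> i' div s = x div s \<and> pioneer s i'} = (+) ?a ` ?F"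
    and ne: "?F \<noteq> {}" by auto
  show ?thesis unfolding last_pioneer_of_def eq
    by (rule mono_Max_commute[symmetric]) (use ne in \<open>auto simp: mono_def\<close>)
qed

lemma card_block_shift:
  assumes "y \<le> x mod s" "\<And>d. d < s \<Longrightarrow> Q d \<longleftrightarrow> Q' (x div s * s + d)"
  shows "card {d. l \<le> d \<and> d < y \<and> Q d} =
    card {i. x div s * s + l \<le> i \<and> i < x div s * s + y \<and> Q' i}"
proof -
  let ?a = "x div s * s"
  have ms: "x mod s < s" using block_size_le by simp
  have "{i. ?a + l \<le> i \<and> i < ?a + y \<and> Q' i} = (+) ?a ` {d. l \<le> d \<and> d < y \<and> Q d}"
  proof (intro equalityI subsetI)
    fix i assume i: "i \<in> {i. ?a + l \<le> i \<and> i < ?a + y \<and> Q' i}"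
    then have "?a \<le> i" by simp
    then have "i = ?a + (i - ?a)" by simp
    then show "i \<in> (+) ?a ` {d. l \<le> d \<and> d < y \<and> Q d}"
      using i assms ms by (intro image_eqI[of _ _ "i - ?a"]) auto
  qed (use assms ms in auto)
  then show ?thesis by (simp add: card_image)
qed

lemma last_pioneer_rank:
  "pioneer_count (x div s * s) + lookup_rank (block_code (x div s * s)) (x mod s) =
     pioneer_count (last_pioneer_of x)"
  "lookup_rank (block_code (x div s * s)) (x mod s) < s"
proof -
  let ?a = "x div s * s" and ?f = "last_pioneer_of x"
  let ?m = "Max {f. f \<le> x mod s \<and> code_pioneer (block_code ?a) f}"
  have s0: "0 < s" by (rule block_size_le)
  have f: "?f = ?a + ?m" by (rule last_pioneer_of_eq)
  then have m: "?m \<le> x mod s" using last_pioneer_facts(1) div_mult_mod_eq[of x s] by linarith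
  have "lookup_rank (block_code ?a) (x mod s) =
      card {d. 0 \<le> d \<and> d < ?m \<and> code_pioneer (block_code ?a) d}"
    by (simp add: lookup_rank_def)
  also have "\<dots> = card {i. ?a + 0 \<le> i \<and> i < ?a + ?m \<and> pioneer s i}"
    using m bit_block_code(3) by (intro card_block_shift) auto
  finally have r: "lookup_rank (block_code ?a) (x mod s) = card {i. ?a \<le> i \<and> i < ?f \<and> pioneer s i}"
    by (simp add: f)
  then show "pioneer_count ?a + lookup_rank (block_code ?a) (x mod s) = pioneer_count ?f"
    unfolding pioneer_count_def using card_less_add[of ?a ?f "pioneer s"] f by simp
  show "lookup_rank (block_code ?a) (x mod s) < s"
    unfolding r using f m s0 by (intro card_between_less) (auto intro: le_less_trans)
qed

lemma last_pioneer_shift: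
  "stack_index s (last_pioneer_of x) + lookup_shift (block_code (x div s * s)) (x mod s) =
     stack_index s x"
proof -
  let ?a = "x div s * s" and ?f = "last_pioneer_of x"
  let ?m = "Max {f. f \<le> x mod s \<and> code_pioneer (block_code ?a) f}"
  have f: "?f = ?a + ?m" by (rule last_pioneer_of_eq)
  have a0: "0 < ?a" using far block_size_le(1)[of n] by auto
  have "lookup_shift (block_code ?a) (x mod s) =
     card {i. ?a + ?m \<le> i \<and> i < ?a + x mod s \<and> p i div s < x div s \<and> last_child i}"
    unfolding lookup_shift_def
  proof (rule card_block_shift)
    fix d assume d: "d < s"
    show "(code_stack (block_code ?a) d = [] \<and> bit (block_code ?a) (4 * d + 1)) \<longleftrightarrow>
        p (?a + d) div s < x div s \<and> last_child (?a + d)"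
      using block_code_facts[OF d, of "x div s"] bit_block_code(2)[OF d, of ?a] a0 by auto
  qed simp
  also have "\<dots> = card {i. ?f \<le> i \<and> i < x \<and> p i div s < x div s \<and> last_child i}"
    by (simp add: f)
  finally show ?thesis
    using stack_index_shift[of s ?f x] last_pioneer_facts far block_size_le(1)[of n] by simp
qed

lemma parent_from_stack:
  "p x div s * s + code_stack (block_code (p x div s * s)) s ! stack_index s x = p x"
proof -
  let ?a = "p x div s * s" and ?y = "p x mod s"
  have s0: "0 < s" by (rule block_size_le)
  have px: "?a + ?y = p x" by simp
  have "?a + s \<le> x"
    using far mult_le_mono1[of "Suc (p x div s)" "x div s" s] div_times_less_eq_dividend[of x s]
    unfolding mult_Suc by linarith
  moreover have "0 < x" using far by (cases x) auto
  ultimately have "open_at (?a + s) (?a + ?y)" unfolding open_at_def px by blast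
  then have "code_stack (block_code ?a) s !
      card {j. ?a + ?y < j \<and> j < ?a + s \<and> open_at (?a + s) j} = ?y"
    using s0 by (intro stack_final bit_block_code) auto
  then show ?thesis
    unfolding stack_index_def Let_def mult_Suc add.commute[of s] px by simp
qed

end

lemma super_rank_facts:
  assumes "i \<le> n"
  shows "super_rank i < S"
    and "super_count (i div S * S) + super_rank i < length super_edges"
    and "p (super_edges ! (super_count (i div S * S) + super_rank i)) div S = p i div S"
proof -
  let ?G = "\<lambda>f. f div S = i div S \<and> p f div S = p i div S"
  define f where "f = (LEAST f. ?G f)"
  have S0: "0 < S" by (rule superblock_size_pos)
  have G: "?G f" unfolding f_def by (rule LeastI[of ?G i]) simp
  have fi: "f \<le> i" unfolding f_def by (rule Least_le[of ?G i]) simp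
  have fe: "first_edge S f"
    unfolding first_edge_def
  proof (intro allI impI)
    fix i' assume i': "i' < f" "i' div S = f div S"
    then have "\<not> ?G i'" using not_less_Least[of i' ?G] by (simp add: f_def)
    then show "p i' div S \<noteq> p f div S" using G i' by auto
  qed
  have sr: "super_rank i = card {z. i div S * S \<le> z \<and> z < f \<and> first_edge S z}"
    by (simp add: super_rank_def f_def)
  have af: "i div S * S \<le> f" using G by (metis div_times_less_eq_dividend)
  have fS: "f < i div S * S + S"
    using G S0 by (metis dividend_less_div_times add.commute)
  show "super_rank i < S" unfolding sr using af fS by (rule card_between_less)
  have cnt: "super_count (i div S * S) + super_rank i = card {z. z < f \<and> first_edge S z}"
    unfolding sr super_count_def using card_less_add[OF af] by simp
  have "f < Suc (n div S) * S"
    using fi assms S0 dividend_less_div_times[of S n] by simp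
  then have "super_edges ! (super_count (i div S * S) + super_rank i) = f"
     "super_count (i div S * S) + super_rank i < length super_edges"
    unfolding cnt super_edges_def using filter_upt_nth[of "first_edge S" f] fe by simp_all
  then show "super_count (i div S * S) + super_rank i < length super_edges"
    "p (super_edges ! (super_count (i div S * S) + super_rank i)) div S = p i div S"
    using G by simp_all
qed

lemma pioneer_count_le: "x \<le> y \<Longrightarrow> pioneer_count x \<le> pioneer_count y"
  unfolding pioneer_count_def by (intro card_mono) auto

lemma count_le: "pioneer_count x \<le> x" "super_count x \<le> x"
proof -
  have "card {i. i < x \<and> Q i} \<le> x" for Q
    using card_mono[of "{..<x}" "{i. i < x \<and> Q i}"] by auto
  then show "pioneer_count x \<le> x" "super_count x \<le> x"
    by (simp_all add: pioneer_count_def super_count_def)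
qed

lemma div_superblock: "x div S = x div s div g"
  by (simp add: superblock_size_def div_mult2_eq)

lemma pioneer_count_offset:
  "pioneer_count (x div s div g * S) + (pioneer_count (x div s * s) - pioneer_count (x div s div g * S)) =
     pioneer_count (x div s * s)"
  "pioneer_count (x div s * s) - pioneer_count (x div s div g * S) < S"
proof -
  let ?A = "x div s div g * S"
  have A: "?A \<le> x div s * s"
  proof -
    have "x div s div g * g * s \<le> x div s * s" by (intro mult_right_mono) auto
    then show ?thesis by (simp add: superblock_size_def ac_simps)
  qed
  have "x div s * s \<le> x" by simp
  also have "x < ?A + S"
    using dividend_less_div_times[OF superblock_size_pos[of n], of x] by (simp add: div_superblock add.commute)
  finally have lt: "x div s * s < ?A + S" .
  show "pioneer_count ?A + (pioneer_count (x div s * s) - pioneer_count ?A) = pioneer_count (x div s * s)"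
    using pioneer_count_le[OF A] by simp
  have "pioneer_count (x div s * s) - pioneer_count ?A =
      card {z. ?A \<le> z \<and> z < x div s * s \<and> pioneer s z}"
    unfolding pioneer_count_def using card_less_add[OF A, of "pioneer s"] by simp
  also have "\<dots> < S" using A lt by (rule card_between_less)
  finally show "pioneer_count (x div s * s) - pioneer_count ?A < S" .
qed

lemma arrays_width: "a \<in> set arrays \<Longrightarrow> 0 < fst a \<and> fst a \<le> long_width n"
  using row_log_bounds(1)[of n] block_size_le[of n] short_width_le[of n]
  by (auto simp: arrays_def long_width_def short_width_def)

lemma length_arrays: "length arrays = 15"
  by (simp add: arrays_def)

lemma arrays_nth:
  "arrays ! 0 = (long_width n, [s, g])"
  "arrays ! 1 = (4 * s, map (\<lambda>b. block_code (b * s)) [0..<Suc (n div s)])"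
  "arrays ! 2 = (long_width n, map (\<lambda>B. pioneer_count (B * S)) [0..<Suc (n div S)])"
  "arrays ! 3 = (short_width n,
     map (\<lambda>b. pioneer_count (b * s) - pioneer_count (b div g * S)) [0..<Suc (n div s)])"
  "arrays ! 4 = (short_width n, map super_rank pioneers)"
  "arrays ! 5 = (short_width n, map (\<lambda>i. p i div s mod g) pioneers)"
  "arrays ! 6 = (short_width n, map (stack_index s) pioneers)"
  "arrays ! 7 = (long_width n, map (\<lambda>B. super_count (B * S)) [0..<Suc (n div S)])"
  "arrays ! 8 = (long_width n, map (\<lambda>i. p i div S) super_edges)"
  "arrays ! 9 = (short_width n, lookup_table s lookup_far)"
  "arrays ! 10 = (short_width n, lookup_table s lookup_near)"
  "arrays ! 11 = (short_width n, lookup_table s lookup_rank)"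
  "arrays ! 12 = (short_width n, lookup_table s lookup_shift)"
  "arrays ! 13 = (short_width n, lookup_table s (\<lambda>X d. code_stack X s ! d))"
  "arrays ! 14 = (short_width n, lookup_table s lookup_mark)"
  by (simp_all add: arrays_def del: upt_Suc)

lemma array_length_le:
  assumes "a \<in> set arrays" shows "length (snd a) \<le> length forest_bits"
proof -
  have "length (snd a) \<le> length (snd a) * fst a" using arrays_width[OF assms] by (cases "fst a") auto
  also have "\<dots> \<le> (\<Sum>a\<leftarrow>arrays. length (snd a) * fst a)"
    using assms by (intro member_le_sum_list) auto
  finally show ?thesis by (simp add: forest_bits_def length_encode)
qed

context
  fixes w :: nat and M :: "nat \<Rightarrow> nat" and x :: nat
  assumes holds: "holds_bits w forest_bits M" and w: "2 * long_width n + 2 \<le> w"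
    and len: "length forest_bits < 2 ^ long_width n"
    and x: "0 < x" "x \<le> n"
begin

abbreviation "ev \<equiv> expr_value w M x"

lemma long_less:
  assumes "(a :: nat) < 2 ^ long_width n" shows "a < 2 ^ w"
proof -
  have "(2 :: nat) ^ long_width n \<le> 2 ^ w" using w by (intro power_increasing) auto
  then show ?thesis using assms by linarith
qed

lemma eval_rd:
  assumes "j < 15" "arrays ! j = (d, xs)" "ev e = i" "i < length xs" "xs ! i = v" "v < 2 ^ d"
  shows "ev (rd j e) = v"
proof -
  have "arrays ! j \<in> set arrays" using assms(1) length_arrays by (intro nth_mem) simp
  from arrays_width[OF this] have "d \<le> long_width n" "0 < d" using assms(2) by simp_all
  then have "ev (rd j e) = snd (arrays ! j) ! i"
    using assms(1,4-6)
    by (intro eval_read_array_encode[OF holds[unfolded forest_bits_def] w len[unfolded forest_bits_def]]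
        assms(3)) (simp_all add: assms(2) length_arrays)
  then show ?thesis using assms(2,5) by simp
qed

lemma eval_rd_upt:
  assumes "j < 15" "arrays ! j = (d, map f [0..<Suc m])" "ev e = i" "i \<le> m" "f i < 2 ^ d"
  shows "ev (rd j e) = f i"
  by (rule eval_rd[OF assms(1-3) _ _ assms(5)]) (use assms(4) in \<open>simp_all del: upt_Suc\<close>)

lemma eval_rd_map:
  assumes "j < 15" "arrays ! j = (d, map f xs)" "ev e = i" "i < length xs" "f (xs ! i) < 2 ^ d"
  shows "ev (rd j e) = f (xs ! i)"
  by (rule eval_rd[OF assms(1-3) _ _ assms(5)]) (use assms(4) in simp_all)

lemma array_index_less:
  assumes "j < 15" "arrays ! j = (d, xs)" "i < length xs"
  shows "i < 2 ^ w"
proof -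
  have "arrays ! j \<in> set arrays" using assms(1) length_arrays by (intro nth_mem) simp
  then have "length xs \<le> length forest_bits" using array_length_le assms(2) by fastforce
  then show ?thesis using assms(3) len by (intro long_less) linarith
qed

lemma small_less:
  "a \<le> n \<Longrightarrow> a < 2 ^ long_width n" "a \<le> S \<Longrightarrow> a < 2 ^ short_width n"
  using n_less_long[of n] superblock_size_less[of n] by linarith+

lemma sizes_le: "s \<le> S" "g \<le> S" "0 < s" "0 < g" "0 < S"
  using row_log_bounds(1)[of n] block_size_le[of n] superblock_size_pos
  by (simp_all add: superblock_size_def Suc_le_eq)

lemma eval_size: "ev length_expr = s" "ev factor_expr = g"
proof -
  have "g \<le> 20 * g" "s \<le> 20 * g" using block_size_le[of n] by simp_all
  then have "s < 2 ^ long_width n" "g < 2 ^ long_width n"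
    unfolding long_width_def using less_exp[of "20 * g"] by linarith+
  moreover have n: "ev (Num 0) = 0" "ev (Num 1) = 1" using w by (simp_all add: take_bit_nat_eq_self_iff)
  ultimately show "ev length_expr = s" "ev factor_expr = g"
    unfolding length_expr_def factor_expr_def
    using eval_rd[OF _ arrays_nth(1) n(1), of s] eval_rd[OF _ arrays_nth(1) n(2), of g] by simp_all
qed

lemma eval_block:
  "ev (block_expr Input) = x div s" "ev (super_expr Input) = x div s div g"
  by (simp_all add: block_expr_def super_expr_def eval_size)

lemma eval_code:
  assumes "ev e = b" "b \<le> n div s"
  shows "ev (code_expr e) = block_code (b * s)"
  unfolding code_expr_def
  by (rule eval_rd_upt[OF _ arrays_nth(2) assms]) (simp_all add: block_code_less)

lemma eval_entry:
  assumes "ev e = b" "b \<le> n div s" "ev e' = d" "d < s"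
  shows "ev (entry_expr e e') = block_code (b * s) * s + d"
proof -
  have "block_code (b * s) * s + d < 2 ^ w"
    by (rule array_index_less[OF _ arrays_nth(10) lookup_table_nth(1)[OF block_code_less assms(4)]]) simp
  then show ?thesis
    unfolding entry_expr_def using eval_code[OF assms(1,2)] eval_size(1) assms(3)
    by (intro eval_Add eval_Mul) simp_all
qed

lemma eval_lookup:
  assumes "j < 15" "arrays ! j = (short_width n, lookup_table s f)"
    and "ev e = block_code a * s + d" "d < s" "f (block_code a) d \<le> S"
  shows "ev (rd j e) = f (block_code a) d"
  by (rule eval_rd[OF assms(1-3)])
    (use lookup_table_nth[OF block_code_less assms(4)] small_less(2)[OF assms(5)] in simp_all)

lemma eval_cell: "ev (cell_expr Input) = block_code (x div s * s) * s + x mod s"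
  unfolding cell_expr_def
  by (rule eval_entry) (use x eval_block sizes_le in \<open>simp_all add: div_le_mono eval_size\<close>)

lemma eval_mark: "ev mark_expr = of_bool (mark x)"
  unfolding mark_expr_def
  by (rule eval_lookup[OF _ arrays_nth(15) eval_cell, unfolded lookup_mark_eq])
    (use sizes_le in simp_all)

lemma eval_far: "ev (rd 9 (cell_expr Input)) = of_bool (p x div s < x div s)"
  by (rule eval_lookup[OF _ arrays_nth(10) eval_cell, unfolded lookup_far_eq[OF x(1)]])
    (use sizes_le in simp_all)

lemma parent_le_n: "p x \<le> n"
  using parent_le[of x] x by simp

lemma eval_near:
  assumes "\<not> p x div s < x div s"
  shows "ev (near_expr Input) = p x"
proof -
  note eq = lookup_near_eq[OF x(1) assms]
  have "x < x div s * s + s" using dividend_less_div_times[OF sizes_le(3), of x] by simp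
  then have "lookup_near (block_code (x div s * s)) (x mod s) \<le> S"
    using eq parent_le[of x] sizes_le(1) by linarith
  then have "ev (rd 10 (cell_expr Input)) = lookup_near (block_code (x div s * s)) (x mod s)"
    using sizes_le by (intro eval_lookup[OF _ arrays_nth(11) eval_cell]) simp_all
  moreover have "p x < 2 ^ w" using small_less(1)[OF parent_le_n] by (rule long_less)
  moreover from this have "ev (Bin Mul (block_expr Input) length_expr) = x div s * s"
    using eq by (intro eval_Mul eval_block eval_size) linarith
  ultimately show ?thesis
    unfolding near_expr_def using eq eval_Add by metis
qed

lemma eval_pioneer:
  assumes far: "p x div s < x div s"
  shows "ev (pioneer_expr Input) = pioneer_count (last_pioneer_of x)"
    and "pioneer_count (last_pioneer_of x) < length pioneers"
    and "pioneers ! pioneer_count (last_pioneer_of x) = last_pioneer_of x"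
proof -
  let ?f = "last_pioneer_of x"
  note lp = last_pioneer_facts[OF far]
  have xN: "x < Suc (n div s) * s" using x dividend_less_div_times[OF sizes_le(3), of n] by simp
  then have "?f < Suc (n div s) * s" using lp(1) by simp
  from filter_upt_nth[of "pioneer s", OF lp(3) this]
  show lt: "pioneer_count ?f < length pioneers" and "pioneers ! pioneer_count ?f = ?f"
    unfolding pioneer_count_def pioneers_def by simp_all
  have cS: "pioneer_count (x div s div g * S) < 2 ^ long_width n"
    using count_le(1)[of "x div s div g * S"] x div_times_less_eq_dividend[of x S]
    by (intro small_less) (simp add: div_superblock)
  have sup: "x div s div g \<le> n div S" using x by (simp add: div_superblock div_le_mono)
  have e2: "ev (rd 2 (super_expr Input)) = pioneer_count (x div s div g * S)"
    by (rule eval_rd_upt[OF _ arrays_nth(3) eval_block(2) sup cS]) simp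
  have e3: "ev (rd 3 (block_expr Input)) =
      pioneer_count (x div s * s) - pioneer_count (x div s div g * S)"
    by (rule eval_rd_upt[OF _ arrays_nth(4) eval_block(1)])
      (use x pioneer_count_offset(2)[of x] small_less(2) in \<open>simp_all add: div_le_mono\<close>)
  have e11: "ev (rd 11 (cell_expr Input)) = lookup_rank (block_code (x div s * s)) (x mod s)"
    using last_pioneer_rank(2)[OF far] sizes_le
    by (intro eval_lookup[OF _ arrays_nth(12) eval_cell]) simp_all
  have lw: "pioneer_count ?f < 2 ^ w"
    by (rule array_index_less[OF _ arrays_nth(5)]) (use lt in simp_all)
  have e23: "ev (Bin Add (rd 2 (super_expr Input)) (rd 3 (block_expr Input))) = pioneer_count (x div s * s)"
    using eval_Add[OF e2 e3] pioneer_count_offset(1)[of x] last_pioneer_rank(1)[OF far] lw by simp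
  show "ev (pioneer_expr Input) = pioneer_count ?f"
    unfolding pioneer_expr_def using eval_Add[OF e23 e11] last_pioneer_rank(1)[OF far] lw by metis
qed

lemma eval_far_expr:
  assumes far: "p x div s < x div s"
  shows "ev (far_expr Input) = p x"
proof -
  let ?f = "last_pioneer_of x"
  note lp = last_pioneer_facts[OF far] and ep = eval_pioneer[OF far]
  have fn: "?f \<le> n" using lp(1) x by simp
  have fS: "?f div S = x div s div g" using lp(2) by (simp add: div_superblock)
  note sr = super_rank_facts[OF fn, unfolded fS]
  have sup: "x div s div g \<le> n div S" using x by (simp add: div_superblock div_le_mono)
  have e4: "ev (rd 4 (pioneer_expr Input)) = super_rank ?f"
    by (rule eval_rd_map[OF _ arrays_nth(5) ep(1,2), unfolded ep(3)]) (use sr(1) small_less(2) in simp_all)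
  have e5: "ev (rd 5 (pioneer_expr Input)) = p x div s mod g"
    by (rule eval_rd_map[OF _ arrays_nth(6) ep(1,2), unfolded ep(3) lp(4)])
      (use sizes_le small_less(2)[of "p x div s mod g"] mod_less_divisor[of g "p x div s"] in linarith)+
  have e6: "ev (rd 6 (pioneer_expr Input)) = stack_index s ?f"
    by (rule eval_rd_map[OF _ arrays_nth(7) ep(1,2), unfolded ep(3)])
      (use sizes_le stack_index_less[OF sizes_le(3), of ?f] small_less(2)[of "stack_index s ?f"] in linarith)+
  have "super_count (x div s div g * S) < 2 ^ long_width n"
    using count_le(2)[of "x div s div g * S"] x div_times_less_eq_dividend[of x S]
    by (intro small_less) (simp add: div_superblock)
  then have e7: "ev (rd 7 (super_expr Input)) = super_count (x div s div g * S)"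
    by (intro eval_rd_upt[OF _ arrays_nth(8) eval_block(2) sup]) simp_all
  have "super_count (x div s div g * S) + super_rank ?f < 2 ^ w"
    by (rule array_index_less[OF _ arrays_nth(9)]) (use sr in simp_all)
  then have e74: "ev (Bin Add (rd 7 (super_expr Input)) (rd 4 (pioneer_expr Input))) =
      super_count (x div s div g * S) + super_rank ?f"
    by (rule eval_Add[OF e7 e4])
  have pS: "p ?f div S = p x div s div g" using lp(4) by (simp add: div_superblock)
  have pn: "p x div s div g \<le> n"
    using parent_le_n div_le_dividend[of "p x div s" g] div_le_dividend[of "p x" s] by linarith
  have e8: "ev (rd 8 (Bin Add (rd 7 (super_expr Input)) (rd 4 (pioneer_expr Input)))) = p x div s div g"
    by (rule eval_rd_map[OF _ arrays_nth(9) e74 sr(2), unfolded sr(3) pS])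
      (use small_less(1)[OF pn] in simp_all)
  have pw: "p x < 2 ^ w" using small_less(1)[OF parent_le_n] long_less by blast
  have tw: "p x div s < 2 ^ w" using pw div_le_dividend[of "p x" s] by linarith
  have dm: "p x div s div g * g + p x div s mod g = p x div s" by simp
  have et: "ev (target_expr Input) = p x div s"
  proof -
    have "ev (target_expr Input) = p x div s div g * g + p x div s mod g"
      unfolding target_expr_def using tw dm
      by (intro eval_Add eval_Mul e8 e5 eval_size) linarith+
    then show ?thesis by simp
  qed
  note sh = last_pioneer_shift[OF far]
  have e12: "ev (rd 12 (cell_expr Input)) = lookup_shift (block_code (x div s * s)) (x mod s)"
    using sh stack_index_less[OF sizes_le(3), of x] sizes_le
    by (intro eval_lookup[OF _ arrays_nth(13) eval_cell]) simp_all
  have "(1 :: nat) < 2 ^ (4 * s)" using sizes_le(3) by (intro one_less_power) auto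
  then have "s < 2 ^ w"
    using array_index_less[OF _ arrays_nth(10), of s] sizes_le lookup_table_nth(1)[of 1 s 0] by simp
  then have ei: "ev (Bin Add (rd 6 (pioneer_expr Input)) (rd 12 (cell_expr Input))) = stack_index s x"
    using eval_Add[OF e6 e12] sh stack_index_less[OF sizes_le(3), of x] by simp
  have bn: "p x div s \<le> n div s" using parent_le_n by (rule div_le_mono)
  note ee = eval_entry[OF et bn ei stack_index_less[OF sizes_le(3)]]
  note ps = parent_from_stack[OF far]
  have "p x < p x div s * s + s" using dividend_less_div_times[OF sizes_le(3), of "p x"] by simp
  then have "code_stack (block_code (p x div s * s)) s ! stack_index s x \<le> S"
    using ps sizes_le(1) by linarith
  then have e13: "ev (rd 13 (entry_expr (target_expr Input)
      (Bin Add (rd 6 (pioneer_expr Input)) (rd 12 (cell_expr Input))))) =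
      code_stack (block_code (p x div s * s)) s ! stack_index s x"
    by (intro eval_lookup[OF _ arrays_nth(14) ee stack_index_less[OF sizes_le(3)]]) simp_all
  have "ev (far_expr Input) = p x div s * s + code_stack (block_code (p x div s * s)) s ! stack_index s x"
    unfolding far_expr_def using ps pw by (intro eval_Add eval_Mul et eval_size e13) linarith+
  then show ?thesis using ps by simp
qed

lemma eval_parent: "ev parent_expr = p x"
proof -
  have pw: "p x < 2 ^ w" using small_less(1)[OF parent_le_n] long_less by blast
  have w0: "0 < w" using w by simp
  have t: "take_bit w (p x) = p x" "take_bit w (Suc 0) = Suc 0"
    using pw w0 by (simp_all add: take_bit_nat_eq_self_iff)
  have "take_bit w (1 + 2 ^ w :: nat) = 1"
    unfolding take_bit_eq_mod mod_add_self2 using w0 by simp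
  then show ?thesis
    using eval_far eval_far_expr eval_near w0 t
    by (cases "p x div s < x div s") (simp_all add: parent_expr_def)
qed

end

end

section \<open>Space\<close>

definition overhead :: "nat \<Rightarrow> nat" where
  "overhead n = 34 * long_width n + 2 + 4 * block_size n
     + 5 * (n div superblock_size n + 1) * long_width n
     + 10 * (n div block_size n + 1) * short_width n
     + 6 * (2 ^ (4 * block_size n) * block_size n) * short_width n"

lemma (in marked_forest) length_forest_bits: "length forest_bits \<le> 4 * n + overhead n"
proof -
  let ?b = "long_width n" and ?h = "short_width n" and ?T = "2 ^ (4 * s) * s"
  have len: "length forest_bits = 34 * ?b + 2 + Suc (n div s) * (4 * s) + 2 * (Suc (n div S) * ?b)
      + Suc (n div s) * ?h + 3 * (length pioneers * ?h) + length super_edges * ?b + 6 * (?T * ?h)"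
    by (simp add: forest_bits_def length_encode length_arrays) (simp add: arrays_def lookup_table_def del: upt_Suc)
  have "Suc (n div s) * (4 * s) \<le> 4 * n + 4 * s"
  proof -
    have "Suc (n div s) * (4 * s) = 4 * (n div s * s) + 4 * s" by (simp add: algebra_simps)
    then show ?thesis using div_times_less_eq_dividend[of n s] by linarith
  qed
  moreover have "length pioneers * ?h \<le> 3 * (Suc (n div s) * ?h)"
    unfolding mult.assoc[symmetric] using length_pioneers by (rule mult_right_mono) simp
  moreover have "length super_edges * ?b \<le> 3 * (Suc (n div S) * ?b)"
    unfolding mult.assoc[symmetric] using length_super_edges by (rule mult_right_mono) simp
  moreover have "overhead n = 34 * ?b + 2 + 4 * s + 5 * (Suc (n div S) * ?b)
      + 10 * (Suc (n div s) * ?h) + 6 * (?T * ?h)"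
    by (simp only: overhead_def Suc_eq_plus1 mult.assoc)
  ultimately show ?thesis
    unfolding len by linarith
qed

lemma power_block_size_le: "4 * block_size n \<le> row_log n div 2 + 4"
  unfolding block_size_def by presburger

lemma space_less: "4 * n + overhead n < 2 ^ long_width n"
proof -
  let ?q = "row_log n" and ?b = "long_width n" and ?h = "short_width n" and ?s = "block_size n"
  define Z where "Z = (2 :: nat) ^ ?q"
  have q: "?q \<le> Z" using less_exp[of ?q] by (simp add: Z_def)
  have Z2: "2 \<le> Z" using row_log_bounds(1)[of n] by (cases ?q) (simp_all add: Z_def)
  have n: "n + 2 \<le> 2 * Z" using row_log_bounds(3)[of n] by (simp add: Z_def)
  have b: "?b \<le> 20 * Z" using q by (simp add: long_width_def)
  have s: "?s \<le> Z" using block_size_le(2)[of n] q by linarith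
  have h: "?h \<le> 2 * Z" using short_width_le[of n] q by linarith
  have d: "n div d + 1 \<le> 2 * Z" for d using n div_le_dividend[of n d] by linarith
  have "(2 :: nat) ^ (4 * ?s) \<le> 2 ^ (?q + 4)"
    using power_block_size_le[of n] by (intro power_increasing) auto
  then have t: "(2 :: nat) ^ (4 * ?s) \<le> 16 * Z" by (simp add: Z_def power_add)
  have le2: "Z \<le> Z ^ 3" "Z ^ 2 \<le> Z ^ 3" "1 \<le> Z ^ 3"
    using Z2 by (simp_all add: self_le_power power_increasing)
  have "5 * (n div superblock_size n + 1) * ?b \<le> 5 * (2 * Z) * (20 * Z)"
    by (intro mult_mono d b) simp_all
  also have "\<dots> = 200 * Z ^ 2" by (simp add: power2_eq_square)
  finally have l: "5 * (n div superblock_size n + 1) * ?b \<le> 200 * Z ^ 2" .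
  have "10 * (n div ?s + 1) * ?h \<le> 10 * (2 * Z) * (2 * Z)"
    by (intro mult_mono d h) simp_all
  also have "\<dots> = 40 * Z ^ 2" by (simp add: power2_eq_square)
  finally have m: "10 * (n div ?s + 1) * ?h \<le> 40 * Z ^ 2" .
  have "6 * (2 ^ (4 * ?s) * ?s) * ?h \<le> 6 * (16 * Z * Z) * (2 * Z)"
    by (intro mult_mono t s h) simp_all
  also have "\<dots> = 192 * Z ^ 3" by (simp add: power3_eq_cube)
  finally have r: "6 * (2 ^ (4 * ?s) * ?s) * ?h \<le> 192 * Z ^ 3" .
  have "4 * n + overhead n \<le> 8 * Z + 680 * Z + 2 + 4 * Z + 240 * Z ^ 2 + 192 * Z ^ 3"
    unfolding overhead_def using n b s l m r by linarith
  also have "\<dots> \<le> 1126 * Z ^ 3" using le2 by linarith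
  also have "\<dots> < 2 ^ 11 * Z ^ 3" using Z2 by simp
  also have "\<dots> \<le> Z ^ 11 * Z ^ 3" using Z2 by (intro mult_right_mono power_mono) auto
  also have "\<dots> = Z ^ 14" by (simp flip: power_add)
  also have "\<dots> \<le> Z ^ 20" using Z2 by (intro power_increasing) auto
  also have "\<dots> = 2 ^ ?b" by (simp add: Z_def long_width_def power_mult[symmetric] mult.commute)
  finally show ?thesis .
qed

lemma row_log_le_log: "real (row_log n) \<le> log 2 (real n + 2)"
proof -
  have "real (2 ^ row_log n) \<le> real (n + 2)" using row_log_bounds(2) of_nat_le_iff by blast
  then show ?thesis by (intro le_log_of_power) simp_all
qed

lemma overhead_smallo: "(\<lambda>n. real (overhead n)) \<in> o(\<lambda>n. real n)"
proof -
  define L where "L = (\<lambda>n :: nat. log 2 (real n + 2))"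
  define B where "B = (\<lambda>n :: nat. 34 * (20 * L n) + 2 + 4 * L n
     + 5 * (32 * real n / (L n)\<^sup>2 + 1) * (20 * L n)
     + 10 * (16 * real n / L n + 1) * (2 * log 2 (L n) + 1)
     + 6 * (16 * sqrt (real n + 2) * L n) * (2 * log 2 (L n) + 1))"
  have le: "real (overhead n) \<le> B n" for n
  proof -
    let ?q = "row_log n" and ?h = "short_width n" and ?s = "block_size n" and ?S = "superblock_size n"
    have qL: "real ?q \<le> L n" using row_log_le_log by (simp add: L_def)
    have q1: "1 \<le> real ?q" using row_log_bounds(1)[of n] by linarith
    have L1: "1 \<le> L n" using q1 qL by linarith
    have "real n + 2 < 2 ^ Suc ?q"
      using row_log_bounds(3)[of n] by (metis of_nat_add of_nat_less_iff of_nat_numeral of_nat_power power_Suc)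
    then have "L n < real (Suc ?q)" unfolding L_def
      by (subst log_less_iff) (simp_all add: powr_realpow del: of_nat_Suc power_Suc)
    then have Lq: "L n \<le> 2 * real ?q" using q1 by simp
    have "real ?q / 8 \<le> real ?s" unfolding block_size_def by linarith
    then have s1: "L n / 16 \<le> real ?s" using Lq by simp
    have s2: "real ?s \<le> L n" using block_size_le(2)[of n] qL by linarith
    have "(L n / 16) * (L n / 2) \<le> real ?s * real ?q"
      using s1 Lq L1 by (intro mult_mono) auto
    then have S1: "(L n)\<^sup>2 / 32 \<le> real ?S" by (simp add: superblock_size_def power2_eq_square)
    have "real ?s * real ?q \<le> L n * L n" using s2 qL L1 by (intro mult_mono) auto
    then have S2: "real ?S \<le> (L n)\<^sup>2" by (simp add: superblock_size_def power2_eq_square)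
    have S0: "0 < real ?S" using superblock_size_pos[of n] by simp
    have h: "real ?h \<le> 2 * log 2 (L n) + 1"
    proof -
      have "2 ^ floor_log ?S \<le> ?S" using superblock_size_pos by (rule floor_log_exp2_le)
      then have "real (2 ^ floor_log ?S) \<le> real ?S" using of_nat_le_iff by blast
      then have "real (floor_log ?S) \<le> log 2 (real ?S)" using S0 by (intro le_log_of_power) simp_all
      also have "\<dots> \<le> log 2 ((L n)\<^sup>2)" using S0 S2 L1 by (subst log_le_cancel_iff) auto
      also have "\<dots> = 2 * log 2 (L n)" using L1 by (simp add: log_nat_power)
      finally show ?thesis by (simp add: short_width_def)
    qed
    have dS: "real (n div ?S + 1) \<le> 32 * real n / (L n)\<^sup>2 + 1"
    proof -
      have "real (n div ?S) \<le> real n / real ?S" by (rule of_nat_div_le_of_nat)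
      also have "\<dots> \<le> real n / ((L n)\<^sup>2 / 32)" using S1 L1 S0 by (intro divide_left_mono mult_pos_pos) auto
      finally show ?thesis by (simp add: mult.commute)
    qed
    have ds: "real (n div ?s + 1) \<le> 16 * real n / L n + 1"
    proof -
      have "real (n div ?s) \<le> real n / real ?s" by (rule of_nat_div_le_of_nat)
      also have "\<dots> \<le> real n / (L n / 16)"
        using s1 L1 block_size_le(1)[of n] by (intro divide_left_mono) auto
      finally show ?thesis by (simp add: mult.commute)
    qed
    have t: "real (2 ^ (4 * ?s)) \<le> 16 * sqrt (real n + 2)"
    proof -
      have "(2 :: real) ^ (4 * ?s) \<le> 2 ^ (?q div 2 + 4)"
        using power_block_size_le[of n] by (intro power_increasing) auto
      moreover have "(2 :: real) ^ (?q div 2) \<le> sqrt (real n + 2)"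
      proof (rule real_le_rsqrt)
        have "((2 :: real) ^ (?q div 2))\<^sup>2 = 2 ^ (?q div 2 * 2)" by (simp add: power_mult)
        also have "\<dots> \<le> 2 ^ ?q" by (intro power_increasing) auto
        also have "\<dots> \<le> real n + 2"
          using row_log_bounds(2)[of n] by (metis of_nat_add of_nat_le_iff of_nat_numeral of_nat_power)
        finally show "((2 :: real) ^ (?q div 2))\<^sup>2 \<le> real n + 2" .
      qed
      ultimately show ?thesis by (simp add: power_add)
    qed
    have b: "real (long_width n) \<le> 20 * L n" using qL by (simp add: long_width_def)
    have f1: "real (5 * (n div ?S + 1) * long_width n) \<le> 5 * (32 * real n / (L n)\<^sup>2 + 1) * (20 * L n)"
      unfolding of_nat_mult using L1 by (intro mult_mono dS b) auto
    have f2: "real (10 * (n div ?s + 1) * ?h) \<le> 10 * (16 * real n / L n + 1) * (2 * log 2 (L n) + 1)"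
      unfolding of_nat_mult using L1 by (intro mult_mono ds h) auto
    have f3: "real (6 * (2 ^ (4 * ?s) * ?s) * ?h) \<le>
        6 * (16 * sqrt (real n + 2) * L n) * (2 * log 2 (L n) + 1)"
      unfolding of_nat_mult using L1 by (intro mult_mono t s2 h) auto
    show ?thesis
      unfolding overhead_def B_def of_nat_add
      by (intro add_mono f1 f2 f3) (use b s2 in simp_all)
  qed
  have "(\<lambda>n. real (overhead n)) \<in> O(B)"
  proof (intro landau_o.big_mono always_eventually allI)
    show "norm (real (overhead n)) \<le> norm (B n)" for n
      using le[of n] by (simp add: abs_ge_self order_trans[OF _ abs_ge_self])
  qed
  also have "B \<in> o(\<lambda>n. real n)"
    unfolding B_def L_def by real_asymp
  finally show ?thesis .
qed

section \<open>The forest of contained linker nodes\<close>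

lemma replicate_Dollar_le: "replicate (length z) Dollar \<le> z"
proof (induction z)
  case (Cons a z)
  have "Dollar \<le> a" by (simp add: less_eq_symbol_def)
  then show ?case using Cons by (auto simp: le_less)
qed simp

lemma append_le_append_same: "x @ y \<le> x @ z \<longleftrightarrow> y \<le> (z :: 'a :: linorder list)"
  by (induction x) simp_all

lemma prefix_between:
  assumes "x @ a \<le> c" "c \<le> x @ b"
  shows "prefix x (c :: 'a :: linorder list)"
  using assms
proof (induction x arbitrary: c)
  case (Cons y x)
  then show ?case by (cases c) auto
qed simp

lemma finite_symbol: "finite (UNIV :: symbol set)"
proof -
  have "(UNIV :: symbol set) = insert Dollar (Base ` {Adenine, Cytosine, Guanine, Thymine})"
    by (auto simp: image_iff) (metis dna.exhaust symbol.exhaust)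
  then show ?thesis by (metis finite.emptyI finite_imageI finite_insert)
qed

lemma llabel_padded: "llabel (replicate j Dollar @ map Base X) = map Base X"
  by (cases X) (simp_all add: llabel_def dropWhile_append)

lemma boss_node_cases:
  assumes "v \<in> boss_nodes Rs k"
  obtains X where "v = replicate (k - 1 - length X) Dollar @ map Base X" "length X \<le> k - 1"
    "llabel v = map Base X"
  using assms
proof -
  assume thes: "\<And>X. v = replicate (k - 1 - length X) Dollar @ map Base X \<Longrightarrow> length X \<le> k - 1 \<Longrightarrow>
    llabel v = map Base X \<Longrightarrow> thesis"
  have "\<exists>X. v = replicate (k - 1 - length X) Dollar @ map Base X \<and> length X \<le> k - 1"
    using assms unfolding boss_nodes_def solid_nodes_def linker_nodes_def by fastforce
  then show thesis using thes llabel_padded by blast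
qed

lemma boss_node:
  assumes "v \<in> boss_nodes Rs k"
  shows "v = replicate (k - 1 - length (llabel v)) Dollar @ llabel v"
    and "Dollar \<notin> set (llabel v)" and "length (llabel v) \<le> k - 1" and "length v = k - 1"
proof -
  obtain X where X: "v = replicate (k - 1 - length X) Dollar @ map Base X" "length X \<le> k - 1"
    "llabel v = map Base X"
    using boss_node_cases[OF assms] .
  show "v = replicate (k - 1 - length (llabel v)) Dollar @ llabel v"
    unfolding X(3) length_map by (rule X(1))
  show "Dollar \<notin> set (llabel v)" "length (llabel v) \<le> k - 1" unfolding X(3) using X(2) by auto
  show "length v = k - 1" using X(1,2) by simp
qed

lemma linker_node:
  assumes "v \<in> linker_nodes Rs k"
  shows "v \<in> boss_nodes Rs k" and "length (llabel v) < k - 1"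
  using assms llabel_padded by (auto simp: boss_nodes_def linker_nodes_def)

lemma llabel_inject:
  assumes "u \<in> boss_nodes Rs k" "v \<in> boss_nodes Rs k" "llabel u = llabel v"
  shows "u = v"
  using boss_node(1)[OF assms(1)] boss_node(1)[OF assms(2)] assms(3) by metis

lemma rev_le_of_suffix:
  assumes "u \<in> boss_nodes Rs k" "v \<in> boss_nodes Rs k" "suffix (llabel u) (llabel v)"
  shows "rev u \<le> rev v"
proof -
  have "suffix (llabel u) v"
    using assms(3) boss_node(1)[OF assms(2)] by (metis suffix_append suffix_order.trans suffixI)
  then obtain z where z: "v = z @ llabel u" by (auto simp: suffix_def)
  then have "length (rev z) = k - 1 - length (llabel u)" using boss_node(4)[OF assms(2)] by simp
  then have "replicate (k - 1 - length (llabel u)) Dollar \<le> rev z"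
    using replicate_Dollar_le by metis
  moreover have "rev u = rev (llabel u) @ replicate (k - 1 - length (llabel u)) Dollar"
    by (subst boss_node(1)[OF assms(1)]) simp
  ultimately show ?thesis by (simp add: z append_le_append_same)
qed

lemma suffix_llabel_between:
  assumes u: "u \<in> boss_nodes Rs k" and v: "v \<in> boss_nodes Rs k" and x: "x \<in> boss_nodes Rs k"
    and "rev u \<le> rev x" "rev x \<le> rev v" "suffix (llabel u) (llabel v)"
  shows "suffix (llabel u) (llabel x)"
proof -
  have ru: "rev u = rev (llabel u) @ replicate (k - 1 - length (llabel u)) Dollar"
    by (subst boss_node(1)[OF u]) simp
  have "suffix (llabel u) v"
    using assms(6) boss_node(1)[OF v] by (metis suffix_append suffix_order.trans suffixI)
  then obtain z where z: "v = z @ llabel u" by (auto simp: suffix_def)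
  have "prefix (rev (llabel u)) (rev x)"
    using prefix_between[of "rev (llabel u)" _ "rev x" "rev z"] assms(4,5) ru z by simp
  then have sx: "suffix (llabel u) x" by (simp add: suffix_to_prefix)
  then have "suffix (llabel u) (replicate (k - 1 - length (llabel x)) Dollar @ llabel x)"
    using boss_node(1)[OF x] by simp
  then have "suffix (llabel u) (llabel x) \<or>
      (\<exists>y. llabel u = y @ llabel x \<and> suffix y (replicate (k - 1 - length (llabel x)) Dollar))"
    unfolding suffix_append .
  then show ?thesis
  proof (elim disjE exE conjE)
    fix y assume y: "llabel u = y @ llabel x" "suffix y (replicate (k - 1 - length (llabel x)) Dollar)"
    have "y = []"
    proof (rule ccontr)
      assume "y \<noteq> []"
      then have "hd y \<in> set y" by simp
      moreover have "set y \<subseteq> {Dollar}" using y(2) by (auto dest!: set_mono_suffix split: if_splits)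
      ultimately have "Dollar \<in> set (llabel u)" using y(1) by auto
      then show False using boss_node(2)[OF u] by simp
    qed
    then show ?thesis using y by simp
  qed simp
qed

locale boss =
  fixes Rs :: "dna list set" and k m :: nat
begin

abbreviation "N \<equiv> boss_nodes Rs k"
abbreviation "rows \<equiv> boss_rows Rs k"
abbreviation "row \<equiv> row_of Rs k"

definition node :: "nat \<Rightarrow> symbol list" where
  "node i = rows ! (i - 1)"

lemma finite_N: "finite N"
proof -
  have "N \<subseteq> {v. set v \<subseteq> UNIV \<and> length v = k - 1}" using boss_node(4) by auto
  then show ?thesis using finite_lists_length_eq[OF finite_symbol] finite_subset by blast
qed

lemma rows_facts: "set rows = N" "distinct rows" "sorted_wrt (\<lambda>u v. rev u < rev v) rows"
proof -
  have fin: "finite (rev ` N)" using finite_N by simp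
  show "set rows = N" using fin by (simp add: boss_rows_def image_image)
  show "distinct rows" by (simp add: boss_rows_def distinct_map)
  have "sorted_wrt (<) (sorted_list_of_set (rev ` N))" by (rule strict_sorted_list_of_set)
  then show "sorted_wrt (\<lambda>u v. rev u < rev v) rows"
    by (simp add: boss_rows_def sorted_wrt_map)
qed

lemma row_node:
  assumes "0 < i" "i \<le> length rows"
  shows "node i \<in> N" "row (node i) = i"
proof -
  have i: "i - 1 < length rows" using assms by simp
  show "node i \<in> N" unfolding node_def using i rows_facts(1) nth_mem by blast
  have "(THE j. j < length rows \<and> rows ! j = node i) = i - 1"
    using i rows_facts(2) by (intro the_equality) (auto simp: node_def nth_eq_iff_index_eq)
  then show "row (node i) = i" using assms by (simp add: row_of_def)
qed

lemma node_row:
  assumes "v \<in> N"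
  shows "0 < row v" "row v \<le> length rows" "node (row v) = v"
proof -
  obtain j where j: "j < length rows" "rows ! j = v" using assms rows_facts(1) by (metis in_set_conv_nth)
  have "node (Suc j) = v" using j by (simp add: node_def)
  then have "row v = Suc j" using row_node(2)[of "Suc j"] j by simp
  then show "0 < row v" "row v \<le> length rows" "node (row v) = v"
    using j \<open>node (Suc j) = v\<close> by simp_all
qed

lemma row_less_iff:
  assumes "u \<in> N" "v \<in> N"
  shows "row u < row v \<longleftrightarrow> rev u < rev v"
proof -
  have *: "rev u < rev v" if "row u < row v" "u \<in> N" "v \<in> N" for u v
    using sorted_wrt_nth_less[OF rows_facts(3), of "row u - 1" "row v - 1"]
      that node_row[OF that(2)] node_row[OF that(3)] by (simp add: node_def)
  show ?thesis
  proof (cases "row u" "row v" rule: linorder_cases)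
    case less
    then show ?thesis using *[OF less assms] by simp
  next
    case equal
    then show ?thesis using node_row(3) assms by (metis order_less_irrefl)
  next
    case greater
    then show ?thesis using *[OF greater assms(2,1)] by (simp add: less_imp_le not_less)
  qed
qed

definition candidates :: "symbol list \<Rightarrow> symbol list set" where
  "candidates v = {u \<in> linker_nodes Rs k. strict_suffix (llabel u) (llabel v) \<and> m \<le> length (llabel u)}"

lemma nextcontained_cases:
  "candidates v = {} \<and> nextcontained Rs k m v = None \<or>
   (\<exists>u\<in>candidates v. nextcontained Rs k m v = Some u \<and>
      (\<forall>u'\<in>candidates v. length (llabel u') \<le> length (llabel u)))"
proof -
  let ?S = "{u. u \<noteq> v \<and> contained_in Rs k u v \<and> strict_suffix (llabel u) (llabel v) \<and> m \<le> length (llabel u)}"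
  have S: "?S = candidates v"
    by (auto simp: candidates_def contained_in_def suffix_order.less_imp_le)
  show ?thesis
  proof (cases "candidates v = {}")
    case True
    then show ?thesis using S by (simp add: nextcontained_def)
  next
    case False
    then obtain u0 where u0: "u0 \<in> candidates v" by blast
    let ?u = "arg_max_on (\<lambda>u. length (llabel u)) (candidates v)"
    have "\<forall>y. y \<in> candidates v \<longrightarrow> length (llabel y) < k"
      using linker_node(2) by (fastforce simp: candidates_def)
    from arg_max_nat_lemma[of "\<lambda>x. x \<in> candidates v", OF u0 this]
    have "?u \<in> candidates v" "\<forall>u'\<in>candidates v. length (llabel u') \<le> length (llabel ?u)"
      unfolding arg_max_on_def by blast+
    moreover have "nextcontained Rs k m v = Some ?u"
      unfolding nextcontained_def Let_def S using False by simp
    ultimately show ?thesis by blast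
  qed
qed

lemma candidates_insert:
  assumes u: "u \<in> candidates v" "\<forall>u'\<in>candidates v. length (llabel u') \<le> length (llabel u)"
  shows "candidates v = insert u (candidates u)"
proof (intro equalityI subsetI)
  fix u' assume u': "u' \<in> candidates v"
  have "suffix (llabel u') (llabel v)" "suffix (llabel u) (llabel v)"
    using u u' by (auto simp: candidates_def suffix_order.less_imp_le)
  then have "suffix (llabel u') (llabel u)" using u(2) u' suffix_length_suffix by blast
  moreover have "u' = u" if "llabel u' = llabel u"
    using that u u' llabel_inject linker_node(1) unfolding candidates_def by blast
  ultimately show "u' \<in> insert u (candidates u)"
    using u' by (auto simp: candidates_def suffix_order.less_le)
next
  fix u' assume "u' \<in> insert u (candidates u)"
  then show "u' \<in> candidates v" using u by (auto simp: candidates_def intro: suffix_order.less_trans)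
qed

lemma card_candidates: "finite (candidates v)" "card (candidates v) \<le> k - 1"
proof -
  have sub: "candidates v \<subseteq> N" using linker_node(1) by (auto simp: candidates_def)
  then show "finite (candidates v)" using finite_N finite_subset by blast
  have inj: "inj_on (\<lambda>u. length (llabel u)) (candidates v)"
  proof (rule inj_onI)
    fix x y assume xy: "x \<in> candidates v" "y \<in> candidates v" "length (llabel x) = length (llabel y)"
    then have "suffix (llabel x) (llabel v)" "suffix (llabel y) (llabel v)"
      by (auto simp: candidates_def suffix_order.less_imp_le)
    then have "suffix (llabel x) (llabel y)" "suffix (llabel y) (llabel x)"
      using xy(3) by (auto intro: suffix_length_suffix)
    then show "x = y" using xy sub llabel_inject suffix_order.antisym by blast
  qed
  have "card (candidates v) \<le> card {..<k - 1}"
    using inj linker_node(2) by (intro card_inj_on_le[OF inj]) (auto simp: candidates_def)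
  then show "card (candidates v) \<le> k - 1" by simp
qed

lemma candidates_row_less: "u \<in> candidates v \<Longrightarrow> v \<in> N \<Longrightarrow> row u < row v"
proof -
  assume u: "u \<in> candidates v" and v: "v \<in> N"
  have uN: "u \<in> N" using u linker_node(1) by (auto simp: candidates_def)
  have "strict_suffix (llabel u) (llabel v)" using u by (simp add: candidates_def)
  then have "rev u \<le> rev v" "u \<noteq> v"
    using rev_le_of_suffix[OF uN v] by (auto simp: suffix_order.less_imp_le)
  then show ?thesis using row_less_iff[OF uN v] by (simp add: le_less)
qed

definition parent :: "nat \<Rightarrow> nat" where
  "parent i = (if 0 < i \<and> i \<le> length rows
     then row_or_dummy Rs k (nextcontained Rs k m (node i)) else 0)"

definition selected :: "nat \<Rightarrow> bool" where
  "selected i \<longleftrightarrow> node i \<in> linker_nodes Rs k \<and> m \<le> length (llabel (node i))"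

lemma parent_cases:
  assumes "0 < i" "i \<le> length rows"
  shows "candidates (node i) = {} \<and> parent i = 0 \<or>
   (\<exists>u\<in>candidates (node i). parent i = row u \<and> 0 < row u \<and> row u < i \<and> row u \<le> length rows \<and> node (row u) = u \<and>
      (\<forall>u'\<in>candidates (node i). length (llabel u') \<le> length (llabel u)))"
proof -
  have "u \<in> N" if "u \<in> candidates (node i)" for u
    using that linker_node(1) by (auto simp: candidates_def)
  then show ?thesis
    using nextcontained_cases[of "node i"] assms row_node[OF assms] candidates_row_less[of _ "node i"] node_row
    unfolding parent_def by (metis row_or_dummy.simps)
qed

sublocale forest parent
proof
  show "parent 0 = 0" by (simp add: parent_def)
next
  fix i :: nat assume i: "0 < i"
  show "parent i < i"
  proof (cases "i \<le> length rows")
    case True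
    then show ?thesis using parent_cases[OF i True] i by auto
  qed (use i in \<open>simp add: parent_def\<close>)
next
  fix i i' :: nat assume i: "0 < i" "i < i'" and lt: "parent i < parent i'"
  have i': "0 < i'" "i' \<le> length rows" using i lt by (auto simp: parent_def split: if_splits)
  obtain u where u: "u \<in> candidates (node i')" "parent i' = row u"
    using parent_cases[OF i'] lt by auto
  show "i \<le> parent i'"
  proof (rule ccontr)
    assume "\<not> i \<le> parent i'"
    then have ui: "row u < i" using u by simp
    have il: "i \<le> length rows" using i i' by simp
    have uN: "u \<in> N" and ul: "u \<in> linker_nodes Rs k" and um: "m \<le> length (llabel u)"
      using u linker_node(1) by (auto simp: candidates_def)
    note ni = row_node[OF i(1) il] and ni' = row_node[OF i']
    have "rev u < rev (node i)" "rev (node i) < rev (node i')"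
      using row_less_iff[OF uN ni(1)] row_less_iff[OF ni(1) ni'(1)] ui i ni ni' by simp_all
    then have su: "suffix (llabel u) (llabel (node i))"
      using suffix_llabel_between[OF uN ni'(1) ni(1)] u
      by (auto simp: candidates_def suffix_order.less_imp_le)
    have "llabel u \<noteq> llabel (node i)"
      using llabel_inject[OF uN ni(1)] ui ni(2) by auto
    then have uc: "u \<in> candidates (node i)"
      using su ul um by (simp add: candidates_def suffix_order.less_le)
    then obtain t where t: "t \<in> candidates (node i)" "parent i = row t"
       "length (llabel u) \<le> length (llabel t)"
      using parent_cases[OF i(1) il] by blast
    have tN: "t \<in> N" using t(1) linker_node(1) by (auto simp: candidates_def)
    have "suffix (llabel t) (llabel (node i))"
      using t(1) by (auto simp: candidates_def suffix_order.less_imp_le)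
    then have "suffix (llabel u) (llabel t)" using su t(3) suffix_length_suffix by blast
    then have "rev u \<le> rev t" using rev_le_of_suffix[OF uN tN] by blast
    then have "\<not> row t < row u" using row_less_iff[OF tN uN] by simp
    then show False using lt t u by simp
  qed
qed

lemma chain_exists: "\<exists>ys. chain parent i ys"
proof (induction i rule: less_induct)
  case (less i)
  show ?case
  proof (cases "parent i")
    case 0
    then show ?thesis using chain.stop by blast
  next
    case (Suc y)
    then have "0 < i" using parent_0 by (cases i) auto
    then obtain ys where "chain parent (Suc y) ys" using less parent_less Suc by metis
    then show ?thesis using chain.more[of parent i, OF Suc] by blast
  qed
qed

lemma chain_facts:
  assumes "chain parent i ys" "0 < i" "i \<le> length rows"
  shows "set ys = row ` candidates (node i)" "distinct ys"
proof -
  have "set ys = row ` candidates (node i) \<and> distinct ys" using assms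
  proof (induction rule: chain.induct)
    case (stop x)
    then show ?case using parent_cases[of x] by auto
  next
    case (more x y ys)
    obtain u where u: "u \<in> candidates (node x)" "row u = Suc y" "Suc y \<le> length rows" "node (Suc y) = u"
        "\<forall>u'\<in>candidates (node x). length (llabel u') \<le> length (llabel u)"
      using parent_cases[of x] more by auto
    have c: "candidates (node x) = insert u (candidates u)" using candidates_insert u by blast
    have IH: "set ys = row ` candidates u" "distinct ys" using more u by simp_all
    have uN: "u \<in> N" using u(1) linker_node(1) by (auto simp: candidates_def)
    have "Suc y \<notin> set ys"
      using candidates_row_less[OF _ uN] u(2) IH(1) by fastforce
    then show ?case using IH u(2) c by simp
  qed
  then show "set ys = row ` candidates (node i)" "distinct ys" by simp_all
qed

lemma chain_length:
  assumes "chain parent i ys" "0 < i" "i \<le> length rows"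
  shows "length ys \<le> k - 1"
proof -
  have "length ys = card (row ` candidates (node i))"
    using chain_facts[OF assms] distinct_card by metis
  also have "\<dots> \<le> card (candidates (node i))" using card_candidates(1) by (rule card_image_le)
  also have "\<dots> \<le> k - 1" by (rule card_candidates)
  finally show ?thesis .
qed

lemma buildL_rows:
  assumes "chain parent i ys" "0 < i" "i \<le> length rows"
  defines "out \<equiv> (if selected i then [i] else []) @ ys"
  shows "distinct out" "set out = row ` buildL Rs k (node i) m"
proof -
  note ni = row_node[OF assms(2,3)] and c = chain_facts[OF assms(1-3)]
  have "i \<notin> set ys" using c(1) candidates_row_less[OF _ ni(1)] ni(2) by fastforce
  then show "distinct out" using c(2) by (simp add: out_def)
  have "buildL Rs k (node i) m = (if selected i then {node i} else {}) \<union> candidates (node i)"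
    using llabel_inject[OF linker_node(1) ni(1)] linker_node(1)
    by (auto simp: buildL_def contained_in_def candidates_def selected_def suffix_order.less_le)
  then show "set out = row ` buildL Rs k (node i) m"
    using c(1) ni(2) by (simp add: out_def image_Un)
qed

end

section \<open>The data structure\<close>

theorem theorem3:
  shows "\<exists>(enc :: dna list set \<Rightarrow> nat \<Rightarrow> nat \<Rightarrow> bool list)
           (next_prog :: instr list) (build_prog :: instr list)
           (slack :: nat \<Rightarrow> real) (c :: nat) (C :: nat).
    slack \<in> o(\<lambda>n. real n) \<and> 1 \<le> C \<and>
    (\<forall>(Rs :: dna list set) (k :: nat) (m :: nat) (n :: nat).
       finite Rs \<longrightarrow> (\<exists>l. \<forall>R\<in>Rs. length R = l) \<longrightarrow> 1 \<le> k \<longrightarrow>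
       n = length (boss_rows Rs k) \<longrightarrow>
         real (length (enc Rs k m)) \<le> 4 * real n + slack n \<and>
         (\<forall>w :: nat. real C * log 2 (real n + 2) \<le> real w \<longrightarrow>
            (\<forall>v\<in>boss_nodes Rs k.
               answers w next_prog (enc Rs k m) (row_of Rs k v) c
                 (\<lambda>out. out = [row_or_dummy Rs k (nextcontained Rs k m v)]) \<and>
               answers w build_prog (enc Rs k m) (row_of Rs k v) (c * k)
                 (\<lambda>out. distinct out \<and> set out = row_of Rs k ` buildL Rs k v m))))"
proof -
  let ?enc = "\<lambda>Rs k m. marked_forest.forest_bits (boss.parent Rs k m) (boss.selected Rs k m)
     (length (boss_rows Rs k))"
  let ?np = "next_program parent_expr" and ?bp = "build_program mark_expr parent_expr"
  define c where "c = length ?np + length (compile mark_expr 2) + 2 + (length (compile parent_expr 2) + 4)"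
  have main: "real (length (?enc Rs k m)) \<le> 4 * real n + real (overhead n) \<and>
         (\<forall>w :: nat. real 42 * log 2 (real n + 2) \<le> real w \<longrightarrow>
            (\<forall>v\<in>boss_nodes Rs k.
               answers w ?np (?enc Rs k m) (row_of Rs k v) c
                 (\<lambda>out. out = [row_or_dummy Rs k (nextcontained Rs k m v)]) \<and>
               answers w ?bp (?enc Rs k m) (row_of Rs k v) (c * k)
                 (\<lambda>out. distinct out \<and> set out = row_of Rs k ` buildL Rs k v m)))"
    if k: "1 \<le> k" and n: "n = length (boss_rows Rs k)" for Rs :: "dna list set" and k m n :: nat
  proof -
    interpret boss Rs k m .
    interpret marked_forest parent selected n by unfold_locales
    have enc: "?enc Rs k m = forest_bits" by (simp add: n)
    have len: "length forest_bits < 2 ^ long_width n"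
      using length_forest_bits space_less[of n] by linarith
    have "real (length forest_bits) \<le> real (4 * n + overhead n)"
      using length_forest_bits of_nat_le_iff by blast
    moreover have "answers w ?np forest_bits (row v) c
                 (\<lambda>out. out = [row_or_dummy Rs k (nextcontained Rs k m v)])"
      "answers w ?bp forest_bits (row v) (c * k)
                 (\<lambda>out. distinct out \<and> set out = row ` buildL Rs k v m)"
      if w: "real 42 * log 2 (real n + 2) \<le> real w" and v: "v \<in> N" for w v
    proof -
      have "real 42 * real (row_log n) \<le> real w"
        using row_log_le_log[of n] w by linarith
      then have "42 * row_log n \<le> w" by (metis of_nat_le_iff of_nat_mult)
      then have lw: "2 * long_width n + 2 \<le> w"
        using row_log_bounds(1)[of n] by (simp add: long_width_def)
      note x = node_row[OF v, folded n]
      have px: "parent (row v) = row_or_dummy Rs k (nextcontained Rs k m v)"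
        using x n by (simp add: parent_def)
      have ev: "expr_value w M y parent_expr = parent y" "expr_value w M y mark_expr = of_bool (selected y)"
        if "holds_bits w forest_bits M" "0 < y" "y \<le> n" for M y
        using eval_parent[OF that(1) lw len that(2,3)] eval_mark[OF that(1) lw len that(2,3)] by blast+
      show "answers w ?np forest_bits (row v) c
                 (\<lambda>out. out = [row_or_dummy Rs k (nextcontained Rs k m v)])"
        unfolding px[symmetric] using ev(1) x by (intro next_program_answers) (auto simp: c_def)
      obtain ys where ys: "chain parent (row v) ys" using chain_exists by blast
      note xn = x(1,2)[unfolded n]
      have ly: "length ys + 1 \<le> k" using chain_length[OF ys xn] k by simp
      let ?a = "length (compile mark_expr 2) + 2" and ?b = "length (compile parent_expr 2) + 4"
      have "1 * ?a + (length ys + 1) * ?b \<le> k * ?a + k * ?b"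
        using k ly by (intro add_mono mult_right_mono) simp_all
      also have "\<dots> \<le> c * k" unfolding c_def by (simp add: algebra_simps)
      finally have t: "1 * ?a + (length ys + 1) * ?b \<le> c * k" .
      have "answers w ?bp forest_bits (row v) (c * k)
          (\<lambda>out. out = (if selected (row v) then [row v] else []) @ ys)"
        using ev x t by (intro build_program_answers[where p = parent and n = n] ys parent_less) auto
      then show "answers w ?bp forest_bits (row v) (c * k)
                 (\<lambda>out. distinct out \<and> set out = row ` buildL Rs k v m)"
        using buildL_rows[OF ys xn] x(3) unfolding answers_def Let_def by auto
    qed
    ultimately show ?thesis unfolding enc by simp
  qed
  show ?thesis
    by (intro exI[of _ ?enc] exI[of _ ?np] exI[of _ ?bp] exI[of _ "\<lambda>n. real (overhead n)"]
        exI[of _ c] exI[of _ 42] conjI allI impI)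
      (use overhead_smallo main in \<open>simp_all\<close>)
qed

end
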